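(* Let $G=(V,E)$ be the infinite rooted binary tree and let $\mathcal{E}$ be the set of its branches, i.e. infinite simple paths starting at the root, each viewed as a set of edges. For $p\in\mathcal{E}$ let $x(p)\in\{0,1\}^E$ be given by $x_e(p)=1$ if $e\in p$ and $x_e(p)=0$ otherwise, and let $\mathcal{X}=\{x(p): p\in\mathcal{E}\}\subset\mathbb{R}^E$. For $\delta>0$ let $\delta\mathcal{X}=\{\delta x: x\in\mathcal{X}\}$. (i) If $\delta\ge\sqrt{2\log 2}$, the space $\delta\mathcal{X}$ admits recovery. (ii) If $\delta<\sqrt{2\log 2}$, the space $\delta\mathcal{X}$ does not admit detection.
   Context: In the infinite rooted binary tree every vertex has exactly two children. Noise: $\xi=(\xi_e)_{e\in E}$ is a family of independent standard real Gaussian random variables. A set $\mathcal{Y}\subset\mathbb{R}^E$ admits recovery if there is a Borel measurable map $T:\mathbb{R}^E\to\mathbb{R}^E$ such that for each $y\in\mathcal{Y}$, $T(y+\xi)=y$ almost surely. It admits detection if there is a Borel measurable map $T:\mathbb{R}^E\to\{0,1\}$ such that $T(\xi)=0$ almost surely and, for every $y\in\mathcal{Y}$, $T(y+\xi)=1$ almost surely. (Borel structure is that of the product topology; $\log$ is the natural logarithm.) *)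

theory Defs
  imports "HOL-Probability.Probability"
begin

section \<open>Recovery and detection in Gaussian noise\<close>

text \<open>
  The space of real families indexed by a countable set is the function type
  \<open>'e \<Rightarrow> real\<close> with \<open>'e\<close> countable; its library topology is the product topology,
  so that \<open>borel\<close> below is the Borel structure of the product topology.
\<close>

definition standard_gaussian_family :: "'a measure \<Rightarrow> ('e \<Rightarrow> 'a \<Rightarrow> real) \<Rightarrow> bool" where
  "standard_gaussian_family M \<xi> \<longleftrightarrow>
     prob_space M \<and>
     prob_space.indep_vars M (\<lambda>_. borel) \<xi> UNIV \<and>
     (\<forall>e. distributed M lborel (\<xi> e) std_normal_density)"

definition admits_recovery ::
    "'a measure \<Rightarrow> ('e::countable \<Rightarrow> 'a \<Rightarrow> real) \<Rightarrow> ('e \<Rightarrow> real) set \<Rightarrow> bool" where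
  "admits_recovery M \<xi> Y \<longleftrightarrow>
     (\<exists>T :: ('e \<Rightarrow> real) \<Rightarrow> ('e \<Rightarrow> real).
        T \<in> borel \<rightarrow>\<^sub>M borel \<and>
        (\<forall>y\<in>Y. AE \<omega> in M. T (\<lambda>e. y e + \<xi> e \<omega>) = y))"

definition admits_detection ::
    "'a measure \<Rightarrow> ('e::countable \<Rightarrow> 'a \<Rightarrow> real) \<Rightarrow> ('e \<Rightarrow> real) set \<Rightarrow> bool" where
  "admits_detection M \<xi> Y \<longleftrightarrow>
     (\<exists>T :: ('e \<Rightarrow> real) \<Rightarrow> nat.
        T \<in> borel \<rightarrow>\<^sub>M count_space {0, 1} \<and>
        (AE \<omega> in M. T (\<lambda>e. \<xi> e \<omega>) = 0) \<and>
        (\<forall>y\<in>Y. AE \<omega> in M. T (\<lambda>e. y e + \<xi> e \<omega>) = 1))"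


section \<open>The infinite rooted binary tree\<close>

text \<open>
  A vertex is the word of left/right choices leading to it from the root \<open>[]\<close>; the
  children of \<open>v\<close> are \<open>v @ [False]\<close> and \<open>v @ [True]\<close>. The pair \<open>(v, b)\<close> stands for the
  undirected edge joining \<open>v\<close> to its child \<open>v @ [b]\<close>; this makes the whole type
  \<open>edge\<close> the edge set, without repetitions since \<open>ends\<close> is injective.
\<close>

type_synonym vertex = "bool list"
type_synonym edge = "vertex \<times> bool"

definition ends :: "edge \<Rightarrow> vertex set" where
  "ends e = {fst e, fst e @ [snd e]}"

definition ray_from_root :: "(nat \<Rightarrow> vertex) \<Rightarrow> bool" where
  "ray_from_root p \<longleftrightarrow>
     p 0 = [] \<and> inj p \<and> (\<forall>n. \<exists>e. ends e = {p n, p (Suc n)})"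

definition path_edges :: "(nat \<Rightarrow> vertex) \<Rightarrow> edge set" where
  "path_edges p = {e. \<exists>n. ends e = {p n, p (Suc n)}}"

definition branches :: "edge set set" where
  "branches = {path_edges p | p. ray_from_root p}"

definition branch_vectors :: "(edge \<Rightarrow> real) set" where
  "branch_vectors = {indicator P | P. P \<in> branches}"

definition scaled :: "real \<Rightarrow> ('e \<Rightarrow> real) set \<Rightarrow> ('e \<Rightarrow> real) set" where
  "scaled \<delta> X = {(\<lambda>e. \<delta> * x e) | x. x \<in> X}"

end

theory Submission imports Defs begin

text \<open>
  Write \<open>\<theta> = sqrt (2 ln 2)\<close> and let \<open>S\<close> denote sums of the observation along downward paths.

  Recovery: below a vertex \<open>v\<close> consider the supremum of \<open>S - \<theta> n\<close> over all downward paths of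
  length \<open>n\<close> from \<open>v\<close>. If \<open>v\<close> is off the planted branch the supremum is almost surely finite:
  by Girsanov, \<open>2^n\<close> times the probability that \<open>n\<close> is the first passage time of \<open>S - \<theta> n\<close>
  above \<open>C\<close> along a fixed path is at most \<open>exp (- \<theta> C)\<close> times the probability of the same event
  for the tilted path, and these events are disjoint in \<open>n\<close>. If \<open>v\<close> lies on the planted branch
  the supremum is infinite, since a Gaussian random walk is almost surely unbounded above; this
  covers the critical case \<open>\<delta> = \<theta>\<close> as well.

  Non-detection: plant a uniformly random branch, restricted to the event that the noise sums along
  the branch stay below \<open>c k + C\<close>. For \<open>c\<close> small the densities with respect to pure noise on finitely
  many levels are bounded in \<open>L^2\<close>: two branches sharing \<open>k\<close> edges contribute
  \<open>exp (k (\<delta>^2/2 + \<delta> c) + \<delta> C)\<close> and meet with probability \<open>2^-k\<close>. So the planted law, which is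
  a nonzero measure, is absolutely continuous with respect to the noise law.
\<close>

section \<open>Gaussian white noise\<close>

definition gauss :: "real measure" where
  "gauss = density lborel (\<lambda>x. ennreal (std_normal_density x))"

definition white :: "('i::countable \<Rightarrow> real) measure" where
  "white = PiM UNIV (\<lambda>_. gauss)"

lemma sets_gauss [simp, measurable_cong]: "sets gauss = sets borel"
  by (simp add: gauss_def)

lemma space_gauss [simp]: "space gauss = UNIV"
  by (simp add: gauss_def)

lemma prob_space_gauss: "prob_space gauss"
  unfolding gauss_def by (rule prob_space_normal_density) simp

text \<open>Countability of the index type is what identifies the product sigma-algebra with the
  Borel one, so later arguments may use either description.\<close>

lemma sets_white [simp, measurable_cong]: "sets white = sets borel"
proof -
  have "sets white = sets (PiM UNIV (\<lambda>_::'a. borel :: real measure))"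
    unfolding white_def by (rule sets_PiM_cong) auto
  then show ?thesis by (simp add: sets_PiM_equal_borel)
qed

lemma space_white [simp]: "space white = UNIV"
  by (simp add: white_def space_PiM PiE_def)

lemma prob_space_white: "prob_space white"
  unfolding white_def by (intro prob_space_PiM prob_space_gauss)

text \<open>Reduction to the canonical space: every almost sure statement about \<open>\<xi>\<close>
  becomes one about \<open>white\<close>, and \<open>M\<close> enters in no other way.\<close>

lemma standard_gaussian_family_law:
  fixes \<xi> :: "'e::countable \<Rightarrow> 'a \<Rightarrow> real"
  assumes "standard_gaussian_family M \<xi>"
  shows standard_gaussian_family_measurable: "(\<lambda>\<omega> e. \<xi> e \<omega>) \<in> borel_measurable M"
    and "distr M borel (\<lambda>\<omega> e. \<xi> e \<omega>) = white"
proof -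
  interpret prob_space M using assms by (simp add: standard_gaussian_family_def)
  have ind: "indep_vars (\<lambda>_. borel) \<xi> UNIV"
    and dist: "\<And>e. distributed M lborel (\<xi> e) std_normal_density"
    using assms by (auto simp: standard_gaussian_family_def)
  have [measurable]: "\<xi> e \<in> borel_measurable M" for e
    using distributed_measurable[OF dist[of e]] by simp
  show "(\<lambda>\<omega> e. \<xi> e \<omega>) \<in> borel_measurable M"
    by (rule measurable_coordinatewise_then_product) simp
  have *: "distr M borel (\<xi> e) = gauss" for e
  proof -
    have "distr M borel (\<xi> e) = distr M lborel (\<xi> e)" by (rule distr_cong) auto
    also have "\<dots> = gauss"
      unfolding gauss_def using dist[of e] by (rule distributed_distr_eq_density)
    finally show ?thesis .
  qed
  have "distr M borel (\<lambda>\<omega> e. \<xi> e \<omega>) = distr M (PiM UNIV (\<lambda>_. borel)) (\<lambda>\<omega>. \<lambda>e\<in>UNIV. \<xi> e \<omega>)"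
    by (rule distr_cong) (auto simp: sets_PiM_equal_borel)
  also have "\<dots> = PiM UNIV (\<lambda>e. distr M borel (\<xi> e))"
    using ind by (subst (asm) indep_vars_iff_distr_eq_PiM) auto
  finally show "distr M borel (\<lambda>\<omega> e. \<xi> e \<omega>) = white"
    by (simp add: * white_def)
qed

text \<open>Reading the noise along distinct indices gives white noise again. Walks along tree paths
  thereby become walks over \<open>nat\<close>.\<close>

lemma distr_white_reindex:
  fixes f :: "'i::countable \<Rightarrow> 'j::countable"
  assumes "inj f"
  shows "distr white borel (\<lambda>z i. z (f i)) = white"
proof -
  have "distr white borel (\<lambda>z i. z (f i)) =
      distr (PiM UNIV (\<lambda>_::'j. gauss)) (PiM UNIV (\<lambda>_::'i. gauss)) (\<lambda>z. \<lambda>i\<in>UNIV. z (f i))"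
    by (rule distr_cong) (auto simp: white_def sets_white[unfolded white_def])
  also have "\<dots> = white" unfolding white_def
    using assms by (intro distr_PiM_reindex prob_space_gauss) auto
  finally show ?thesis .
qed

lemma measurable_reindex:
  fixes f :: "'i::countable \<Rightarrow> 'j::countable"
  shows "(\<lambda>(z :: 'j \<Rightarrow> real) i. z (f i)) \<in> borel_measurable borel"
  by (rule measurable_coordinatewise_then_product) simp

lemma distr_white_coordinate: "distr white borel (\<lambda>z. z i) = gauss"
proof -
  interpret product_prob_space "\<lambda>_::'a. gauss" UNIV
    by (intro product_prob_spaceI prob_space_gauss)
  have "distr white borel (\<lambda>z. z i) = distr (PiM UNIV (\<lambda>_::'a. gauss)) gauss (\<lambda>z. z i)"
    unfolding white_def by (rule distr_cong) auto
  then show ?thesis using PiM_component[of i] by simp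
qed

lemma indep_vars_white:
  "prob_space.indep_vars (white :: ('i::countable \<Rightarrow> real) measure) (\<lambda>_. borel) (\<lambda>i z. z i) UNIV"
proof -
  interpret prob_space "white :: ('i \<Rightarrow> real) measure" by (rule prob_space_white)
  have "distr white (PiM UNIV (\<lambda>_. borel)) (\<lambda>x. \<lambda>i\<in>UNIV. x i) = distr white white (\<lambda>x::'i \<Rightarrow> real. x)"
    by (rule distr_cong) (auto simp: sets_PiM_equal_borel)
  also have "\<dots> = PiM UNIV (\<lambda>i. distr white borel (\<lambda>z::'i \<Rightarrow> real. z i))"
    unfolding distr_white_coordinate distr_id by (rule white_def)
  finally show ?thesis
    by (subst indep_vars_iff_distr_eq_PiM) auto
qed

section \<open>Change of measure for shifted noise (Cameron-Martin)\<close>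

lemma nn_integral_gauss_shift:
  assumes [measurable]: "f \<in> borel_measurable borel"
  shows "(\<integral>\<^sup>+x. f (a + x) \<partial>gauss) = (\<integral>\<^sup>+x. f x * ennreal (exp (a * x - a\<^sup>2 / 2)) \<partial>gauss)"
proof -
  have "(\<integral>\<^sup>+x. f x * ennreal (exp (a * x - a\<^sup>2 / 2)) \<partial>gauss)
      = (\<integral>\<^sup>+x. ennreal (std_normal_density x) * (f x * ennreal (exp (a * x - a\<^sup>2 / 2))) \<partial>lborel)"
    unfolding gauss_def by (subst nn_integral_density) auto
  also have "\<dots> = (\<integral>\<^sup>+x. ennreal (std_normal_density (x - a)) * f x \<partial>lborel)"
  proof (rule nn_integral_cong)
    fix x :: real
    \<comment> \<open>Completing the square:
      \<open>- x^2/2 + a * x - a^2/2 = - (x - a)^2/2\<close>.\<close>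
    have "std_normal_density x * exp (a * x - a\<^sup>2 / 2) = std_normal_density (x - a)"
      by (simp add: std_normal_density_def exp_add[symmetric] power2_eq_square field_simps)
    then show "ennreal (std_normal_density x) * (f x * ennreal (exp (a * x - a\<^sup>2 / 2))) =
        ennreal (std_normal_density (x - a)) * f x"
      by (metis ennreal_mult'' exp_ge_zero mult.assoc mult.commute)
  qed
  also have "\<dots> = (\<integral>\<^sup>+x. ennreal (std_normal_density x) * f (a + x) \<partial>lborel)"
    by (subst nn_integral_real_affine[where c = 1 and t = a]) auto
  also have "\<dots> = (\<integral>\<^sup>+x. f (a + x) \<partial>gauss)"
    unfolding gauss_def by (subst nn_integral_density) auto
  finally show ?thesis ..
qed

lemma nn_integral_white_prod:
  fixes g :: "'i::countable \<Rightarrow> real \<Rightarrow> ennreal"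
  assumes "finite J" and [measurable]: "\<And>i. g i \<in> borel_measurable borel"
  shows "(\<integral>\<^sup>+z. (\<Prod>i\<in>J. g i (z i)) \<partial>white) = (\<Prod>i\<in>J. \<integral>\<^sup>+x. g i x \<partial>gauss)"
proof -
  interpret prob_space "white :: ('i \<Rightarrow> real) measure" by (rule prob_space_white)
  have "indep_vars (\<lambda>_. borel) (\<lambda>i z. g i (z i)) J"
    by (rule indep_vars_compose2[where M' = "\<lambda>_. borel"])
       (auto intro: indep_vars_subset[OF indep_vars_white])
  then have "(\<integral>\<^sup>+z. (\<Prod>i\<in>J. g i (z i)) \<partial>white) = (\<Prod>i\<in>J. \<integral>\<^sup>+z. g i (z i) \<partial>white)"
    using assms(1) by (intro indep_vars_nn_integral) auto
  also have "\<dots> = (\<Prod>i\<in>J. \<integral>\<^sup>+x. g i x \<partial>distr white borel (\<lambda>z::'i \<Rightarrow> real. z i))"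
    by (intro prod.cong refl nn_integral_distr[symmetric]) auto
  finally show ?thesis by (simp add: distr_white_coordinate)
qed

text \<open>Both laws are compared on finite-dimensional rectangles. There all integrands factor
  over coordinates, and each factor is handled by the one-dimensional shift formula. Finite support
  of \<open>y\<close> keeps the exponent a finite sum.\<close>

lemma nn_integral_white_shift:
  fixes y :: "'i::countable \<Rightarrow> real"
  assumes F: "finite F" "\<And>i. i \<notin> F \<Longrightarrow> y i = 0"
    and [measurable]: "f \<in> borel_measurable borel"
  shows "(\<integral>\<^sup>+z. f (\<lambda>i. y i + z i) \<partial>white) =
    (\<integral>\<^sup>+z. f z * ennreal (exp (\<Sum>i\<in>F. y i * z i - (y i)\<^sup>2 / 2)) \<partial>white)"
proof -
  let ?D = "\<lambda>z. ennreal (exp (\<Sum>i\<in>F. y i * z i - (y i)\<^sup>2 / 2))"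
  interpret prob_space "white :: ('i \<Rightarrow> real) measure" by (rule prob_space_white)
  have sh: "(\<lambda>z i. y i + z i) \<in> borel_measurable (white :: ('i \<Rightarrow> real) measure)"
    by (rule measurable_coordinatewise_then_product) simp
  have "distr white borel (\<lambda>z i. y i + z i) = density white ?D"
  proof (rule measure_eqI_PiM_infinite[where I = UNIV and M = "\<lambda>_. gauss"])
    fix A :: "'i \<Rightarrow> real set" and J :: "'i set"
    assume J: "finite J" and "\<And>i. i \<in> J \<Longrightarrow> A i \<in> sets gauss"
    then have A: "\<And>i. i \<in> J \<Longrightarrow> A i \<in> sets borel" by simp
    \<comment> \<open>Padding with the constant 1 lets the rectangle over \<open>J\<close> and the
      density over \<open>F\<close> be written as products over the same index set
      \<open>J \<union> F\<close>.\<close>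
    define g :: "'i \<Rightarrow> real \<Rightarrow> ennreal" where "g i = (if i \<in> J then indicator (A i) else (\<lambda>_. 1))" for i
    have [measurable]: "g i \<in> borel_measurable borel" for i
      using A by (auto simp: g_def)
    let ?B = "prod_emb UNIV (\<lambda>_. gauss) J (Pi\<^sub>E J A)"
    have B: "?B = {z. \<forall>i\<in>J. z i \<in> A i}"
      by (auto simp: prod_emb_def PiE_def restrict_Pi_cancel Pi_iff)
    have Bm [measurable]: "?B \<in> sets borel"
    proof -
      have "?B = (\<Inter>i\<in>J. (\<lambda>z. z i) -` A i)" unfolding B by auto
      moreover have "(\<lambda>z. z i) -` A i \<in> sets borel" if "i \<in> J" for i
        using measurable_sets[OF measurable_product_coordinates A[OF that], of i] by simp
      then have "(\<Inter>i\<in>J. (\<lambda>z. z i) -` A i) \<in> sets borel"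
        using J by (cases "J = {}") (auto intro!: sets.finite_INT)
      ultimately show ?thesis by simp
    qed
    let ?U = "J \<union> F"
    have U: "finite ?U" using J F by simp
    have ind: "indicator ?B z = (\<Prod>i\<in>?U. g i (z i))" for z
    proof (cases "z \<in> ?B")
      case True
      then have "(\<Prod>i\<in>?U. g i (z i)) = 1" by (intro prod.neutral) (auto simp: g_def B)
      then show ?thesis using True by simp
    next
      case False
      then obtain i where "i \<in> J" "z i \<notin> A i" by (auto simp: B)
      then have "g i (z i) = 0" "i \<in> ?U" by (auto simp: g_def)
      then have "(\<Prod>i\<in>?U. g i (z i)) = 0" using U by (auto simp: prod_zero_iff)
      then show ?thesis using False by simp
    qed
    have D: "?D z = (\<Prod>i\<in>?U. ennreal (exp (y i * z i - (y i)\<^sup>2 / 2)))" for z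
    proof -
      have "?D z = (\<Prod>i\<in>F. ennreal (exp (y i * z i - (y i)\<^sup>2 / 2)))"
        using F(1) by (simp add: exp_sum prod_ennreal)
      also have "\<dots> = (\<Prod>i\<in>?U. ennreal (exp (y i * z i - (y i)\<^sup>2 / 2)))"
        using U F(2) by (intro prod.mono_neutral_left) auto
      finally show ?thesis .
    qed
    have "emeasure (distr white borel (\<lambda>z i. y i + z i)) ?B = (\<integral>\<^sup>+z. indicator ?B z \<partial>distr white borel (\<lambda>z i. y i + z i))"
      by simp
    also have "\<dots> = (\<integral>\<^sup>+z. (\<Prod>i\<in>?U. g i (y i + z i)) \<partial>white)"
      using nn_integral_distr[OF sh, of "indicator ?B"] unfolding ind by simp
    also have "\<dots> = (\<Prod>i\<in>?U. \<integral>\<^sup>+x. g i (y i + x) \<partial>gauss)"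
      by (rule nn_integral_white_prod[OF U]) simp
    also have "\<dots> = (\<Prod>i\<in>?U. \<integral>\<^sup>+x. g i x * ennreal (exp (y i * x - (y i)\<^sup>2 / 2)) \<partial>gauss)"
      by (intro prod.cong refl nn_integral_gauss_shift) simp
    also have "\<dots> = (\<integral>\<^sup>+z. (\<Prod>i\<in>?U. g i (z i) * ennreal (exp (y i * z i - (y i)\<^sup>2 / 2))) \<partial>white)"
      by (rule nn_integral_white_prod[OF U, symmetric]) simp
    also have "\<dots> = (\<integral>\<^sup>+z. ?D z * indicator ?B z \<partial>white)"
    proof (rule nn_integral_cong)
      show "(\<Prod>i\<in>?U. g i (z i) * ennreal (exp (y i * z i - (y i)\<^sup>2 / 2))) = ?D z * indicator ?B z" for z
        unfolding ind D prod.distrib by (rule mult.commute)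
    qed
    also have "\<dots> = emeasure (density white ?D) ?B"
      by (subst emeasure_density) auto
    finally show "emeasure (distr white borel (\<lambda>z i. y i + z i)) ?B = emeasure (density white ?D) ?B" .
  next
    show "finite_measure (distr white borel (\<lambda>z i. y i + z i))"
      by (rule finite_measure_distr[OF sh])
  qed (auto simp: sets_white[unfolded white_def])
  then have "(\<integral>\<^sup>+z. f (\<lambda>i. y i + z i) \<partial>white) = (\<integral>\<^sup>+z. f z \<partial>density white ?D)"
    using nn_integral_distr[OF sh, of f] by simp
  also have "\<dots> = (\<integral>\<^sup>+z. f z * ?D z \<partial>white)"
    by (subst nn_integral_density) (simp_all add: mult.commute)
  finally show ?thesis .
qed

text \<open>The Laplace transform follows from normalization: the density of the shift by
  \<open>a\<close> on \<open>F\<close> integrates to 1.\<close>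

lemma nn_integral_white_exp:
  fixes F :: "'i::countable set" and a :: real
  assumes "finite F"
  shows "(\<integral>\<^sup>+z. ennreal (exp (a * (\<Sum>i\<in>F. z i))) \<partial>white) = ennreal (exp (card F * a\<^sup>2 / 2))"
proof -
  interpret prob_space "white :: ('i \<Rightarrow> real) measure" by (rule prob_space_white)
  let ?y = "\<lambda>i. if i \<in> F then a else 0"
  let ?D = "\<lambda>z. ennreal (exp (\<Sum>i\<in>F. ?y i * z i - (?y i)\<^sup>2 / 2))"
  have "ennreal (exp (a * (\<Sum>i\<in>F. z i))) = ennreal (exp (card F * a\<^sup>2 / 2)) * ?D z" for z :: "'i \<Rightarrow> real"
    by (simp add: ennreal_mult''[symmetric] exp_add[symmetric] sum_subtractf sum_distrib_left)
  then have "(\<integral>\<^sup>+z. ennreal (exp (a * (\<Sum>i\<in>F. z i))) \<partial>white) =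
      ennreal (exp (card F * a\<^sup>2 / 2)) * (\<integral>\<^sup>+z. ?D z \<partial>white)"
    by (simp only:) (rule nn_integral_cmult, simp)
  also have "(\<integral>\<^sup>+z. ?D z \<partial>white) = 1"
    using nn_integral_white_shift[OF assms, of ?y "\<lambda>_. 1"] emeasure_space_1 by simp
  finally show ?thesis by simp
qed

section \<open>The Gaussian random walk\<close>

text \<open>Chernoff bound: the indicator is dominated by \<open>exp (l * (S - a))\<close>, where
  \<open>S\<close> is the sum.\<close>

lemma white_sum_tail:
  fixes F :: "'i::countable set" and l :: real
  assumes "finite F" "l \<ge> 0"
  shows "emeasure white {z. a < (\<Sum>i\<in>F. z i)} \<le> ennreal (exp (card F * l\<^sup>2 / 2 - l * a))"
proof -
  have "emeasure white {z. a < (\<Sum>i\<in>F. z i)} = (\<integral>\<^sup>+z. indicator {z. a < (\<Sum>i\<in>F. z i)} z \<partial>(white :: ('i \<Rightarrow> real) measure))"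
    by (rule nn_integral_indicator[symmetric]) measurable
  also have "\<dots> \<le> (\<integral>\<^sup>+z. ennreal (exp (- l * a)) * ennreal (exp (l * (\<Sum>i\<in>F. z i))) \<partial>white)"
  proof (rule nn_integral_mono)
    fix z :: "'i \<Rightarrow> real"
    have "1 \<le> exp (- l * a) * exp (l * (\<Sum>i\<in>F. z i))" if "a < (\<Sum>i\<in>F. z i)"
      using that assms(2) mult_left_mono[of a "\<Sum>i\<in>F. z i" l] by (simp add: exp_add[symmetric])
    then show "indicator {z. a < (\<Sum>i\<in>F. z i)} z \<le> ennreal (exp (- l * a)) * ennreal (exp (l * (\<Sum>i\<in>F. z i)))"
      by (auto simp: indicator_def ennreal_mult''[symmetric])
  qed
  also have "\<dots> = ennreal (exp (- l * a)) * ennreal (exp (card F * l\<^sup>2 / 2))"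
    by (subst nn_integral_cmult) (simp_all add: nn_integral_white_exp[OF assms(1)])
  also have "\<dots> = ennreal (exp (card F * l\<^sup>2 / 2 - l * a))"
    by (simp add: ennreal_mult''[symmetric] exp_add[symmetric])
  finally show ?thesis .
qed

text \<open>A union bound over \<open>k\<close>, using the Chernoff bound with \<open>l = c\<close>,
  is a geometric series with prefactor \<open>exp (- (c * C))\<close>, which is small for large
  \<open>C\<close>.\<close>

lemma white_walk_below_line:
  fixes c :: real
  assumes "c > 0"
  obtains C where "C \<ge> 0" "emeasure white {z :: nat \<Rightarrow> real. \<forall>k. (\<Sum>i<k. z i) \<le> c * k + C} > 0"
proof -
  interpret prob_space "white :: (nat \<Rightarrow> real) measure" by (rule prob_space_white)
  define q where "q = exp (- c\<^sup>2 / 2)"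
  have q: "0 < q" "q < 1" using assms by (auto simp: q_def)
  \<comment> \<open>Chosen so that \<open>exp (- (c * C)) = (1 - q) / 2\<close>, which makes the
    geometric series sum to exactly 1/2.\<close>
  define C where "C = ln (2 / (1 - q)) / c"
  have C0: "C \<ge> 0" using q assms by (auto simp: C_def intro!: divide_nonneg_pos ln_ge_zero simp: field_simps)
  have eC: "exp (- (c * C)) = (1 - q) / 2" using q assms by (simp add: C_def exp_minus)
  let ?G = "{z :: nat \<Rightarrow> real. \<forall>k. (\<Sum>i<k. z i) \<le> c * k + C}"
  let ?A = "\<lambda>k::nat. {z :: nat \<Rightarrow> real. c * k + C < (\<Sum>i<k. z i)}"
  have A [measurable]: "?A k \<in> sets borel" for k by measurable
  have G: "?G = UNIV - (\<Union>k. ?A k)" by (auto simp flip: not_le)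
  have "emeasure white (\<Union>k. ?A k) \<le> (\<Sum>k. emeasure white (?A k))"
    by (rule emeasure_subadditive_countably) auto
  also have "\<dots> \<le> (\<Sum>k. ennreal (exp (- (c * C)) * q ^ k))"
  proof (intro suminf_le allI)
    fix k :: nat
    have "emeasure white (?A k) \<le> ennreal (exp (card {..<k} * c\<^sup>2 / 2 - c * (c * k + C)))"
      using assms by (intro white_sum_tail) auto
    also have "exp (card {..<k} * c\<^sup>2 / 2 - c * (c * k + C)) = exp (- (c * C)) * q ^ k"
      by (simp add: q_def exp_of_nat_mult[symmetric] exp_add[symmetric] power2_eq_square field_simps)
    finally show "emeasure white (?A k) \<le> ennreal (exp (- (c * C)) * q ^ k)" .
  qed auto
  also have "(\<lambda>k. exp (- (c * C)) * q ^ k) sums (exp (- (c * C)) * (1 / (1 - q)))"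
    using q by (intro sums_mult geometric_sums) auto
  then have "(\<Sum>k. ennreal (exp (- (c * C)) * q ^ k)) = ennreal (exp (- (c * C)) * (1 / (1 - q)))"
    using q by (intro suminf_ennreal_eq) auto
  also have "exp (- (c * C)) * (1 / (1 - q)) = 1 / 2" unfolding eC using q by simp
  finally have le: "emeasure white (\<Union>k. ?A k) \<le> ennreal (1 / 2)" .
  then have "measure white (\<Union>k. ?A k) \<le> 1 / 2"
    unfolding emeasure_eq_measure by (subst (asm) ennreal_le_iff) auto
  moreover have "measure white ?G = 1 - measure white (\<Union>k. ?A k)"
    unfolding G by (subst prob_compl[symmetric]) auto
  ultimately have "emeasure white ?G > 0" by (simp add: emeasure_eq_measure)
  with C0 show ?thesis by (rule that)
qed

lemma gauss_greaterThan_pos: "measure gauss {a<..} > 0"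
proof -
  interpret prob_space gauss by (rule prob_space_gauss)
  have "{a<..} \<notin> null_sets gauss"
  proof
    assume "{a<..} \<in> null_sets gauss"
    then have "AE x in lborel. x \<in> {a<..} \<longrightarrow> ennreal (std_normal_density x) = 0"
      unfolding gauss_def by (subst (asm) null_sets_density_iff) auto
    moreover have "ennreal (std_normal_density x) \<noteq> 0" for x
      using normal_density_pos[of 1 0 x] by (simp add: ennreal_eq_0_iff not_le)
    ultimately have "AE x in lborel. x \<notin> {a<..}" by auto
    then have "AE x in lborel. x \<notin> {a<..a+1}" by auto
    then have "emeasure lborel {a<..a+1} = 0"
      by (subst (asm) AE_iff_measurable[where N = "{a<..a+1}"]) auto
    then show False by simp
  qed
  then show ?thesis
    by (simp add: null_sets_def emeasure_eq_measure zero_less_measure_iff)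
qed

text \<open>Each event of exceeding \<open>C\<close> has at least the probability that a standard
  Gaussian exceeds 1, and this survives the decreasing limit in \<open>C\<close>. The limit is a
  tail event of positive probability, so Kolmogorov's zero-one law applies.\<close>

lemma white_walk_unbounded:
  "AE z in (white :: (nat \<Rightarrow> real) measure). \<forall>C::nat. \<exists>n. real C < (\<Sum>i<n. z i)"
proof -
  interpret prob_space "white :: (nat \<Rightarrow> real) measure" by (rule prob_space_white)
  let ?S = "\<lambda>(C::nat) (z :: nat \<Rightarrow> real). \<exists>n. real C < (\<Sum>i<n. z i)"
  define E where "E = {z. \<forall>C. ?S C z}"
  have [measurable]: "{z. ?S C z} \<in> sets borel" for C by measurable
  have Em [measurable]: "E \<in> sets borel" unfolding E_def by measurable
  define p where "p = measure gauss {1<..}"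
  have p: "p > 0" unfolding p_def by (rule gauss_greaterThan_pos)
  have ge: "p \<le> prob {z. ?S C z}" for C
  proof -
    \<comment> \<open>With \<open>sqrt n = C + 1\<close>, a normalized sum above 1 means a sum above
      \<open>C + 1\<close>.\<close>
    define n where "n = (C + 1)\<^sup>2"
    have n: "n > 0" "sqrt n = C + 1" by (auto simp: n_def)
    have d1: "distributed white lborel (\<lambda>z. z i) (normal_density 0 1)" for i :: nat
    proof -
      have "distr white lborel (\<lambda>z. z i) = distr white borel (\<lambda>z. z i)" by (rule distr_cong) auto
      then show ?thesis
        by (auto simp: distributed_def distr_white_coordinate gauss_def)
    qed
    have "distributed white lborel (\<lambda>z. \<Sum>i<n. z i) (normal_density (\<Sum>i<n. 0) (sqrt (\<Sum>i<n. 1\<^sup>2)))"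
      using n(1) by (intro sum_indep_normal indep_vars_subset[OF indep_vars_white] d1) auto
    then have "distributed white lborel (\<lambda>z. \<Sum>i<n. z i) (normal_density 0 (sqrt n))" by simp
    then have "distributed white lborel (\<lambda>z. ((\<Sum>i<n. z i) - 0) / sqrt n) std_normal_density"
      using n(1) by (subst (asm) normal_standard_normal_convert) auto
    then have "distr white lborel (\<lambda>z. ((\<Sum>i<n. z i) - 0) / sqrt n) = gauss"
      unfolding gauss_def by (rule distributed_distr_eq_density)
    then have "p = measure (distr white lborel (\<lambda>z. ((\<Sum>i<n. z i) - 0) / sqrt n)) {1<..}"
      by (simp add: p_def)
    also have "\<dots> = prob ((\<lambda>z. ((\<Sum>i<n. z i) - 0) / sqrt n) -` {1<..} \<inter> space white)"
      by (rule measure_distr) auto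
    also have "\<dots> \<le> prob {z. ?S C z}"
    proof (rule finite_measure_mono)
      show "(\<lambda>z. ((\<Sum>i<n. z i) - 0) / sqrt n) -` {1<..} \<inter> space white \<subseteq> {z. ?S C z}"
      proof safe
        fix z :: "nat \<Rightarrow> real" assume "1 < ((\<Sum>i<n. z i) - 0) / sqrt n"
        then have "real C < (\<Sum>i<n. z i)" unfolding n(2) by (simp add: field_simps)
        then show "?S C z" by blast
      qed
    qed auto
    finally show ?thesis .
  qed
  have dec: "decseq (\<lambda>C. {z. ?S C z})"
  proof (rule decseq_SucI, safe)
    fix C n and z :: "nat \<Rightarrow> real" assume "real (Suc C) < (\<Sum>i<n. z i)"
    then show "?S C z" by (intro exI[of _ n]) auto
  qed
  have "(\<lambda>C. prob {z. ?S C z}) \<longlonglongrightarrow> prob (\<Inter>C. {z. ?S C z})"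
    by (rule finite_Lim_measure_decseq[OF _ dec]) auto
  then have "p \<le> prob (\<Inter>C. {z. ?S C z})"
    by (rule LIMSEQ_le_const) (use ge in auto)
  also have "(\<Inter>C. {z. ?S C z}) = E" by (auto simp: E_def)
  finally have pos: "prob E > 0" using p by simp
  \<comment> \<open>The sigma-algebras generated by single coordinates, in the form produced by
    unfolding \<open>indep_vars\<close>.\<close>
  define A :: "nat \<Rightarrow> (nat \<Rightarrow> real) set set" where
    "A i = sigma_sets (space white) {(\<lambda>z. z i) -` B \<inter> space white | B. B \<in> sets borel}" for i
  have "E \<in> tail_events A"
    unfolding tail_events_def
  proof
    fix m :: nat
    let ?G = "\<Union> (A ` {m..})"
    let ?M = "sigma UNIV ?G"
    have coord: "(\<lambda>z. z (m + i)) \<in> borel_measurable ?M" for i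
    proof (rule measurableI)
      fix B :: "real set" assume B: "B \<in> sets borel"
      have "(\<lambda>z. z (m + i)) -` B \<in> A (m + i)" using B by (auto simp: A_def intro!: sigma_sets.Basic)
      then have "(\<lambda>z. z (m + i)) -` B \<in> sigma_sets UNIV ?G" by (intro sigma_sets.Basic) auto
      then show "(\<lambda>z. z (m + i)) -` B \<inter> space ?M \<in> sets ?M" by simp
    qed simp
    have split: "(\<Sum>i<m + n. z i) = (\<Sum>i<m. z i) + (\<Sum>i<n. z (m + i))" for z :: "nat \<Rightarrow> real" and n
      by (induction n) auto
    \<comment> \<open>Removing the first \<open>m\<close> summands changes all later sums by one
      fixed number, so unboundedness depends only on the coordinates from \<open>m\<close>
      on.\<close>
    have "E = {z. \<forall>C::nat. \<exists>n. real C < (\<Sum>i<n. z (m + i))}" (is "_ = ?E")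
    proof (intro set_eqI iffI)
      fix z assume z: "z \<in> E"
      define B where "B = Max ((\<lambda>n. \<Sum>i<n. z i) ` {..m})"
      have B: "(\<Sum>i<n. z i) \<le> B" if "n \<le> m" for n unfolding B_def using that by (intro Max_ge) auto
      show "z \<in> ?E"
      proof safe
        \<comment> \<open>obtain \<open>C'\<close> exceeds all partial sums up to \<open>m\<close>,
          which forces \<open>m < n\<close>, and also leaves room for subtracting the first
          block.\<close>
        fix C :: nat
        obtain C' :: nat where C': "max (B) (C + (\<Sum>i<m. z i)) < C'" using reals_Archimedean2 by blast
        obtain n where n: "C' < (\<Sum>i<n. z i)" using z by (auto simp: E_def)
        have "m < n" using B[of n] n C' by force
        then obtain k where "n = m + k" using less_imp_add_positive by blast
        then have "real C < (\<Sum>i<k. z (m + i))" using n C' by (simp add: split)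
        then show "\<exists>n. real C < (\<Sum>i<n. z (m + i))" ..
      qed
    next
      fix z assume z: "z \<in> ?E"
      show "z \<in> E" unfolding E_def
      proof safe
        fix C :: nat
        obtain C' :: nat where C': "C - (\<Sum>i<m. z i) < C'" using reals_Archimedean2 by blast
        obtain n where n: "C' < (\<Sum>i<n. z (m + i))" using z by auto
        then have "real C < (\<Sum>i<m + n. z i)" using C' by (simp add: split)
        then show "?S C z" by blast
      qed
    qed
    moreover have "Measurable.pred ?M (\<lambda>z. \<forall>C::nat. \<exists>n. real C < (\<Sum>i<n. z (m + i)))"
      using coord by measurable
    then have "?E \<in> sets ?M" by (auto simp: pred_def)
    ultimately show "E \<in> sigma_sets (space white) ?G" by simp
  qed
  moreover have "sigma_algebra (space white) (A i)" for i
    unfolding A_def by (rule sigma_algebra_sigma_sets) auto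
  moreover have "indep_sets A UNIV"
    using indep_vars_white[where 'i = nat] unfolding indep_vars_def A_def by blast
  ultimately have "prob E = 1" using kolmogorov_0_1_law[of A E] pos by auto
  then have "AE z in white. z \<in> E" by (subst prob_eq_1[symmetric]) auto
  then show ?thesis by (simp add: E_def)
qed

section \<open>First passage over the critical line\<close>

definition first_passage :: "real \<Rightarrow> nat \<Rightarrow> (nat \<Rightarrow> real) set" where
  "first_passage C n = {z. sqrt (2 * ln 2) * n + C < (\<Sum>i<n. z i) \<and>
    (\<forall>j<n. (\<Sum>i<j. z i) \<le> sqrt (2 * ln 2) * j + C)}"

lemma first_passage_measurable [measurable]: "first_passage C n \<in> sets borel"
  unfolding first_passage_def by measurable

text \<open>The factor \<open>2 ^ n\<close> counts words of length \<open>n\<close>. With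
  \<open>t = sqrt (2 * ln 2)\<close>, the density of the shift by \<open>t\<close> is at least
  \<open>exp (t * C) * 2 ^ n\<close> on the passage event. The passage times of the shifted walk are
  mutually exclusive, so their probabilities add up to at most 1.\<close>

lemma white_first_passage:
  "(\<Sum>n. 2 ^ n * emeasure white (first_passage C n)) \<le> ennreal (exp (- sqrt (2 * ln 2) * C))"
proof -
  interpret prob_space "white :: (nat \<Rightarrow> real) measure" by (rule prob_space_white)
  define t :: real where "t = sqrt (2 * ln 2)"
  have t: "t > 0" "t\<^sup>2 = 2 * ln 2" by (auto simp: t_def)
  have sh: "(\<lambda>(z :: nat \<Rightarrow> real) i. t + z i) \<in> borel_measurable borel"
    by (rule measurable_coordinatewise_then_product) simp
  \<comment> \<open>All coordinates are shifted here, so the \<open>H n\<close> are first passages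
    of one single drifted walk and hence disjoint.\<close>
  define H where "H n = {z. (\<lambda>i. t + z i) \<in> first_passage C n}" for n
  have Hm [measurable]: "H n \<in> sets borel" for n
  proof -
    have "H n = (\<lambda>(z :: nat \<Rightarrow> real) i. t + z i) -` first_passage C n \<inter> space borel"
      by (auto simp: H_def)
    then show ?thesis using measurable_sets[OF sh first_passage_measurable[of C n]] by (simp only:)
  qed
  have disj: "disjoint_family H"
    unfolding disjoint_family_on_def
  proof safe
    fix m n z assume "m \<noteq> n" "z \<in> H m" "z \<in> H n"
    then show "z \<in> {}" unfolding H_def first_passage_def
      by (cases "m < n") (force dest: spec[of _ m] spec[of _ n])+
  qed
  have le: "ennreal (exp (t * C)) * (2 ^ n * emeasure white (first_passage C n)) \<le> emeasure white (H n)" for n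
  proof -
    \<comment> \<open>The shift formula requires finite support. The event sees only the first
      \<open>n\<close> coordinates, so shifting just those gives the same event
      \<open>H n\<close>.\<close>
    let ?y = "\<lambda>i. if i < n then t else 0"
    let ?h = "first_passage C n"
    have iff: "(\<lambda>i. ?y i + z i) \<in> ?h \<longleftrightarrow> z \<in> H n" for z
    proof -
      have "(\<Sum>i<k. ?y i + z i) = (\<Sum>i<k. t + z i)" if "k \<le> n" for k
        using that by (intro sum.cong) auto
      then show ?thesis by (auto simp: H_def first_passage_def)
    qed
    have "ennreal (exp (t * C)) * (2 ^ n * emeasure white ?h) = ennreal (exp (t * C) * 2 ^ n) * (\<integral>\<^sup>+z. indicator ?h z \<partial>white)"
      by (simp add: ennreal_mult'' mult.assoc ennreal_power[symmetric])
    also have "\<dots> = (\<integral>\<^sup>+z. ennreal (exp (t * C) * 2 ^ n) * indicator ?h z \<partial>white)"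
      by (rule nn_integral_cmult[symmetric]) simp
    also have "\<dots> \<le> (\<integral>\<^sup>+z. indicator ?h z * ennreal (exp (\<Sum>i\<in>{..<n}. ?y i * z i - (?y i)\<^sup>2 / 2)) \<partial>white)"
    proof (rule nn_integral_mono)
      fix z :: "nat \<Rightarrow> real"
      have "exp (t * C) * 2 ^ n \<le> exp (\<Sum>i\<in>{..<n}. ?y i * z i - (?y i)\<^sup>2 / 2)" if "z \<in> ?h"
      proof -
        have "t * n + C < (\<Sum>i<n. z i)" using that by (simp add: first_passage_def t_def)
        then have *: "t * (t * n + C) \<le> t * (\<Sum>i<n. z i)" using t(1) by (intro mult_left_mono) auto
        have "exp (t * C) * 2 ^ n = exp (t * C + n * ln 2)"
          by (simp add: exp_add exp_of_nat_mult)
        \<comment> \<open>The choice of slope enters here: \<open>t^2 / 2 = ln 2\<close>, so the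
          binary branching exactly balances the normalization of the density.\<close>
        also have "t * C + n * ln 2 = t * (t * n + C) - n * (t\<^sup>2 / 2)"
          using t(2) by (simp add: power2_eq_square algebra_simps)
        also have "\<dots> \<le> t * (\<Sum>i<n. z i) - n * (t\<^sup>2 / 2)" using * by simp
        also have "\<dots> = (\<Sum>i\<in>{..<n}. ?y i * z i - (?y i)\<^sup>2 / 2)"
          by (simp add: sum_subtractf sum_distrib_left)
        finally show ?thesis by simp
      qed
      then show "ennreal (exp (t * C) * 2 ^ n) * indicator ?h z
          \<le> indicator ?h z * ennreal (exp (\<Sum>i\<in>{..<n}. ?y i * z i - (?y i)\<^sup>2 / 2))"
        by (auto simp: indicator_def intro!: ennreal_leI)
    qed
    also have "\<dots> = (\<integral>\<^sup>+z. indicator ?h (\<lambda>i. ?y i + z i) \<partial>white)"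
      by (rule nn_integral_white_shift[symmetric]) auto
    also have "\<dots> = (\<integral>\<^sup>+z. indicator (H n) z \<partial>white)"
      by (intro nn_integral_cong) (simp add: indicator_def iff)
    also have "\<dots> = emeasure white (H n)" by simp
    finally show ?thesis .
  qed
  have "ennreal (exp (t * C)) * (\<Sum>n. 2 ^ n * emeasure white (first_passage C n))
      = (\<Sum>n. ennreal (exp (t * C)) * (2 ^ n * emeasure white (first_passage C n)))"
    by (rule ennreal_suminf_cmult[symmetric])
  also have "\<dots> \<le> (\<Sum>n. emeasure white (H n))" by (intro suminf_le le) auto
  also have "\<dots> = emeasure white (\<Union>n. H n)" by (rule suminf_emeasure) (auto simp: disj)
  also have "\<dots> \<le> 1" by (rule emeasure_le_1)
  finally have "ennreal (exp (- t * C)) * (ennreal (exp (t * C)) * (\<Sum>n. 2 ^ n * emeasure white (first_passage C n)))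
      \<le> ennreal (exp (- t * C)) * 1" by (rule mult_left_mono) simp
  then show ?thesis
    by (simp add: mult.assoc[symmetric] ennreal_mult''[symmetric] exp_add[symmetric] t_def)
qed

section \<open>Recovery\<close>

definition edge_at :: "vertex \<Rightarrow> (nat \<Rightarrow> bool) \<Rightarrow> nat \<Rightarrow> edge" where
  "edge_at v b k = (v @ map b [0..<k], b k)"

lemma edge_at_eq_iff:
  "edge_at v b i = edge_at v b' j \<longleftrightarrow> i = j \<and> (\<forall>k\<le>i. b k = b' k)"
proof
  assume *: "edge_at v b i = edge_at v b' j"
  then have "map b [0..<i] = map b' [0..<j]" "b i = b' j" by (auto simp: edge_at_def)
  moreover from this have "i = j" by (metis length_map length_upt minus_nat.diff_0)
  ultimately show "i = j \<and> (\<forall>k\<le>i. b k = b' k)" by (auto simp: le_less)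
qed (auto simp: edge_at_def)

lemma inj_edge_at: "inj (edge_at v b)"
  by (auto simp: inj_def edge_at_eq_iff)

lemma ends_edge_at: "ends (edge_at [] b n) = {map b [0..<n], map b [0..<Suc n]}"
  by (simp add: ends_def edge_at_def)

lemma ends_inject: "ends e = ends e' \<Longrightarrow> e = e'"
  by (cases e; cases e') (auto simp: ends_def doubleton_eq_iff dest: arg_cong[of _ _ length])

text \<open>The first step leaves the root downwards, and after a downward step the only way up
  leads to the vertex just left, which injectivity forbids. So every step appends one bit.\<close>

lemma ray_from_root_iff: "ray_from_root p \<longleftrightarrow> (\<exists>b. p = (\<lambda>n. map b [0..<n]))"
proof
  assume p: "ray_from_root p"
  then have p0: "p 0 = []" and inj: "inj p" by (auto simp: ray_from_root_def)
  have step: "(\<exists>c. p (Suc n) = p n @ [c]) \<or> (\<exists>c. p n = p (Suc n) @ [c])" for n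
  proof -
    obtain e where "ends e = {p n, p (Suc n)}" using p unfolding ray_from_root_def by blast
    then show ?thesis unfolding ends_def doubleton_eq_iff by metis
  qed
  have up: "\<exists>c. p (Suc n) = p n @ [c]" for n
  proof (induction n)
    case 0
    show ?case using step[of 0] by (auto simp: p0)
  next
    case (Suc n)
    then obtain c where c: "p (Suc n) = p n @ [c]" ..
    show ?case using step[of "Suc n"]
    proof
      assume "\<exists>d. p (Suc n) = p (Suc (Suc n)) @ [d]"
      then have "p (Suc (Suc n)) = p n" using c by auto
      then show ?thesis using injD[OF inj, of "Suc (Suc n)" n] by simp
    qed
  qed
  then obtain b where b: "\<And>n. p (Suc n) = p n @ [b n]" by metis
  have "p n = map b [0..<n]" for n
    by (induction n) (auto simp: p0 b)
  then show "\<exists>b. p = (\<lambda>n. map b [0..<n])" by blast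
next
  assume "\<exists>b. p = (\<lambda>n. map b [0..<n])"
  then obtain b where p: "p = (\<lambda>n. map b [0..<n])" ..
  have "inj p" unfolding p inj_def by (metis length_map length_upt minus_nat.diff_0)
  moreover have "\<exists>e. ends e = {p n, p (Suc n)}" for n
    using ends_edge_at[of b n] unfolding p by blast
  ultimately show "ray_from_root p" by (auto simp: ray_from_root_def p)
qed

lemma path_edges_map: "path_edges (\<lambda>n. map b [0..<n]) = range (edge_at [] b)"
proof -
  have "path_edges (\<lambda>n. map b [0..<n]) = {e. \<exists>n. ends e = ends (edge_at [] b n)}"
    by (simp only: path_edges_def ends_edge_at)
  then show ?thesis using ends_inject by blast
qed

lemma scaled_branch_vectors:
  "scaled \<delta> branch_vectors = range (\<lambda>b e. \<delta> * indicator (range (edge_at [] b)) e)"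
proof -
  have "branches = range (\<lambda>b. range (edge_at [] b))"
    unfolding branches_def ray_from_root_iff using path_edges_map by blast
  moreover have "scaled \<delta> branch_vectors = (\<lambda>P e. \<delta> * indicator P e) ` branches"
    unfolding scaled_def branch_vectors_def by blast
  ultimately have "scaled \<delta> branch_vectors
      = (\<lambda>P e. \<delta> * indicator P e) ` (\<lambda>b. range (edge_at [] b)) ` UNIV" by simp
  then show ?thesis unfolding image_image .
qed

section \<open>Suprema of sums over downward paths\<close>

definition word_sum :: "vertex \<Rightarrow> bool list \<Rightarrow> (edge \<Rightarrow> real) \<Rightarrow> real" where
  "word_sum v w z = (\<Sum>i<length w. z (v @ take i w, w ! i))"

text \<open>Infinite supremum of the path sums minus the critical line. Natural \<open>C\<close> and
  finite words make this a countable combination of Borel events.\<close>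

definition escapes :: "vertex \<Rightarrow> (edge \<Rightarrow> real) \<Rightarrow> bool" where
  "escapes v z \<longleftrightarrow> (\<forall>C::nat. \<exists>w. sqrt (2 * ln 2) * length w + C < word_sum v w z)"

lemma word_sum_measurable [measurable]: "word_sum v w \<in> borel_measurable borel"
  unfolding word_sum_def by measurable

lemma escapes_measurable [measurable]: "Measurable.pred borel (escapes v)"
  unfolding escapes_def by measurable

lemma word_sum_map: "word_sum v (map b [0..<n]) z = (\<Sum>i<n. z (edge_at v b i))"
  unfolding word_sum_def edge_at_def by (intro sum.cong) (auto simp: take_map)

text \<open>A word above the line has a shortest prefix above it, at which the walk along that
  prefix first passes. A union bound over the \<open>2 ^ n\<close> prefixes of each length
  \<open>n\<close> leads to the first passage series.\<close>

lemma white_exists_high_word: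
  "emeasure white {z. \<exists>w. sqrt (2 * ln 2) * length w + C < word_sum v w z}
    \<le> ennreal (exp (- sqrt (2 * ln 2) * C))"
proof -
  \<comment> \<open>Padding a word by \<open>False\<close> turns it into an infinite path along
    which the noise is white. The passage event at time \<open>length w\<close> does not see the
    padding.\<close>
  define ext where "ext w i \<longleftrightarrow> i < length w \<and> w ! i" for w i
  have ext: "map (ext w) [0..<j] = take j w" if "j \<le> length w" for w j
    using that by (intro nth_equalityI) (auto simp: ext_def)
  define fp where "fp w = (\<lambda>z i. z (edge_at v (ext w) i)) -` first_passage C (length w)" for w
  have fp [measurable]: "fp w \<in> sets borel" for w
    using measurable_sets[OF measurable_reindex first_passage_measurable, of "edge_at v (ext w)"]
    unfolding fp_def by simp
  have em: "emeasure white (fp w) = emeasure white (first_passage C (length w))" for w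
  proof -
    have m: "(\<lambda>z i. z (edge_at v (ext w) i)) \<in> borel_measurable white"
      by (rule measurable_coordinatewise_then_product) simp
    have "emeasure (distr white borel (\<lambda>z i. z (edge_at v (ext w) i))) (first_passage C (length w)) = emeasure white (fp w)"
      by (subst emeasure_distr[OF m]) (auto simp: fp_def)
    then show ?thesis by (simp only: distr_white_reindex[OF inj_edge_at])
  qed
  have fin: "finite {w :: bool list. length w = n}" and cd: "card {w :: bool list. length w = n} = 2 ^ n" for n
    using finite_lists_length_eq[of "UNIV :: bool set" n] card_lists_length_eq[of "UNIV :: bool set" n] by auto
  let ?U = "\<lambda>n. \<Union>w\<in>{w. length w = n}. fp w"
  have U [measurable]: "?U n \<in> sets borel" for n
    using fin by (intro sets.finite_UN) auto
  have "{z. \<exists>w. sqrt (2 * ln 2) * length w + C < word_sum v w z} \<subseteq> (\<Union>n. ?U n)"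
  proof safe
    fix z w assume w: "sqrt (2 * ln 2) * length w + C < word_sum v w z"
    let ?P = "\<lambda>j. sqrt (2 * ln 2) * j + C < word_sum v (take j w) z"
    define j where "j = (LEAST j. ?P j)"
    have P: "?P (length w)" using w by simp
    then have j: "?P j" and j_le: "j \<le> length w" unfolding j_def by (rule LeastI, rule Least_le)
    have least: "word_sum v (take k w) z \<le> sqrt (2 * ln 2) * k + C" if "k < j" for k
      using not_less_Least[of k ?P] that by (simp add: j_def)
    have sum: "(\<Sum>i<k. z (edge_at v (ext (take j w)) i)) = word_sum v (take k w) z" if "k \<le> j" for k
      using that j_le by (subst word_sum_map[symmetric]) (simp add: ext min_def)
    have "z \<in> fp (take j w)"
      using j j_le least by (simp add: fp_def first_passage_def sum min_absorb2)
    then show "z \<in> (\<Union>n. ?U n)" by blast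
  qed
  then have "emeasure white {z. \<exists>w. sqrt (2 * ln 2) * length w + C < word_sum v w z} \<le> emeasure white (\<Union>n. ?U n)"
    by (rule emeasure_mono) measurable
  also have "\<dots> \<le> (\<Sum>n. emeasure white (?U n))"
    by (rule emeasure_subadditive_countably) auto
  also have "\<dots> \<le> (\<Sum>n. 2 ^ n * emeasure white (first_passage C n))"
  proof (intro suminf_le allI)
    fix n
    have "emeasure white (?U n) \<le> (\<Sum>w | length w = n. emeasure white (fp w))"
      using fin by (intro emeasure_subadditive_finite) auto
    also have "\<dots> = (\<Sum>w::bool list | length w = n. emeasure white (first_passage C n))"
      by (intro sum.cong) (auto simp: em)
    also have "\<dots> = 2 ^ n * emeasure white (first_passage C n)" by (simp add: cd)
    finally show "emeasure white (?U n) \<le> 2 ^ n * emeasure white (first_passage C n)" .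
  qed auto
  also have "\<dots> \<le> ennreal (exp (- sqrt (2 * ln 2) * C))" by (rule white_first_passage)
  finally show ?thesis .
qed

lemma white_not_escapes: "AE z in white. \<not> escapes v z"
proof -
  let ?t = "sqrt (2 * ln 2) :: real"
  have le: "emeasure white {z. escapes v z} \<le> ennreal (exp (- ?t * real C))" for C :: nat
  proof -
    have "emeasure white {z. escapes v z} \<le> emeasure white {z. \<exists>w. ?t * length w + C < word_sum v w z}"
      by (rule emeasure_mono) (auto simp: escapes_def)
    also have "\<dots> \<le> ennreal (exp (- ?t * real C))" by (rule white_exists_high_word)
    finally show ?thesis .
  qed
  have "(\<lambda>C::nat. exp (- ?t * real C)) \<longlonglongrightarrow> 0"
  proof -
    have "(\<lambda>C::nat. exp (- ?t) ^ C) \<longlonglongrightarrow> 0"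
      by (rule LIMSEQ_power_zero) simp
    then show ?thesis by (simp add: exp_of_nat2_mult[symmetric])
  qed
  then have "(\<lambda>C::nat. ennreal (exp (- ?t * real C))) \<longlonglongrightarrow> ennreal 0"
    by (rule tendsto_ennrealI)
  then have "emeasure white {z. escapes v z} \<le> ennreal 0"
    by (rule LIMSEQ_le_const) (use le in auto)
  then show ?thesis by (subst AE_iff_measurable[OF _ refl]) auto
qed

lemma white_path_unbounded:
  fixes f :: "nat \<Rightarrow> 'i::countable"
  assumes "inj f"
  shows "AE z in white. \<forall>C::nat. \<exists>n. real C < (\<Sum>i<n. z (f i))"
proof -
  have m: "(\<lambda>z i. z (f i)) \<in> borel_measurable white"
    by (rule measurable_coordinatewise_then_product) simp
  have "AE z in distr white borel (\<lambda>z i. z (f i)). \<forall>C::nat. \<exists>n. real C < (\<Sum>i<n. z i)"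
    unfolding distr_white_reindex[OF assms] by (rule white_walk_unbounded)
  then show ?thesis by (rule AE_distrD[OF m])
qed

text \<open>Below a planted edge the signal covers the slope of the line and the remaining noise
  walk is unbounded. Below any other edge there is no signal at all, and pure noise does not
  escape.\<close>

lemma recovery_supercritical:
  assumes \<xi>: "standard_gaussian_family M \<xi>" and d: "\<delta> \<ge> sqrt (2 * ln 2)"
  shows "admits_recovery M \<xi> (scaled \<delta> branch_vectors)"
proof -
  let ?t = "sqrt (2 * ln 2) :: real"
  \<comment> \<open>An edge is declared planted when the subtree below its lower endpoint
    escapes.\<close>
  define T :: "(edge \<Rightarrow> real) \<Rightarrow> edge \<Rightarrow> real" where
    "T z e = (if escapes (fst e @ [snd e]) z then \<delta> else 0)" for z e
  have "T \<in> borel \<rightarrow>\<^sub>M borel"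
  proof (rule measurable_coordinatewise_then_product)
    show "(\<lambda>z. T z e) \<in> borel_measurable borel" for e unfolding T_def by measurable
  qed
  moreover have "AE \<omega> in M. T (\<lambda>e. y e + \<xi> e \<omega>) = y" if y_in: "y \<in> scaled \<delta> branch_vectors" for y
  proof -
    obtain b where y: "y = (\<lambda>e. \<delta> * indicator (range (edge_at [] b)) e)"
      using y_in unfolding scaled_branch_vectors by blast
    have "AE z in white. \<forall>v. \<not> escapes v z"
      by (subst AE_all_countable) (simp add: white_not_escapes)
    moreover have "AE z in white. \<forall>k. \<forall>C::nat. \<exists>n. real C < (\<Sum>i<n. z (edge_at [] b (k + i)))"
    proof (subst AE_all_countable, rule allI)
      fix k
      have "inj (\<lambda>i. edge_at [] b (k + i))" by (auto simp: inj_def edge_at_eq_iff)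
      then show "AE z in white. \<forall>C::nat. \<exists>n. real C < (\<Sum>i<n. z (edge_at [] b (k + i)))"
        by (rule white_path_unbounded)
    qed
    ultimately have "AE z in white. T (\<lambda>e. y e + z e) = y"
    proof eventually_elim
      fix z :: "edge \<Rightarrow> real"
      assume off: "\<forall>v. \<not> escapes v z"
        and on: "\<forall>k. \<forall>C::nat. \<exists>n. real C < (\<Sum>i<n. z (edge_at [] b (k + i)))"
      have "escapes (fst e @ [snd e]) (\<lambda>e. y e + z e) \<longleftrightarrow> e \<in> range (edge_at [] b)" for e
      proof
        assume "e \<in> range (edge_at [] b)"
        then obtain k where e: "e = edge_at [] b k" by blast
        have v: "fst e @ [snd e] = map b [0..<Suc k]" by (simp add: e edge_at_def)
        \<comment> \<open>Continuing along \<open>b\<close> from depth \<open>Suc k\<close> traces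
          the tail of the planted branch.\<close>
        have "map b [0..<m] @ map (\<lambda>i. b (m + i)) [0..<i] = map b [0..<m + i]" for m i
          by (induction i) auto
        then have at: "edge_at (map b [0..<Suc k]) (\<lambda>i. b (Suc k + i)) i = edge_at [] b (Suc k + i)" for i
          unfolding edge_at_def by (metis append_Nil)
        show "escapes (fst e @ [snd e]) (\<lambda>e. y e + z e)"
          unfolding escapes_def v
        proof
          fix C :: nat
          obtain n where n: "real C < (\<Sum>i<n. z (edge_at [] b (Suc k + i)))" using on by blast
          let ?w = "map (\<lambda>i. b (Suc k + i)) [0..<n]"
          have "word_sum (map b [0..<Suc k]) ?w (\<lambda>e. y e + z e) = \<delta> * n + (\<Sum>i<n. z (edge_at [] b (Suc k + i)))"
            unfolding word_sum_map at by (simp add: y sum.distrib)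
          \<comment> \<open>The threshold condition enters here. In the critical case the two sides
            agree, and the unbounded noise walk alone exceeds \<open>C\<close>.\<close>
          moreover have "?t * n \<le> \<delta> * n" using d by (rule mult_right_mono) simp
          ultimately show "\<exists>w. ?t * length w + C < word_sum (map b [0..<Suc k]) w (\<lambda>e. y e + z e)"
            using n by (intro exI[of _ ?w]) simp
        qed
      next
        assume esc: "escapes (fst e @ [snd e]) (\<lambda>e. y e + z e)"
        show "e \<in> range (edge_at [] b)"
        proof (rule ccontr)
          assume e: "e \<notin> range (edge_at [] b)"
          \<comment> \<open>A planted edge below \<open>e\<close> would make the lower endpoint of
            \<open>e\<close> a prefix of the branch, and then \<open>e\<close> itself would be
            planted.\<close>
          have "y ((fst e @ [snd e]) @ u, c) = 0" for u c
          proof -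
            have "((fst e @ [snd e]) @ u, c) \<noteq> edge_at [] b n" for n
            proof
              assume "((fst e @ [snd e]) @ u, c) = edge_at [] b n"
              then have eq: "fst e @ [snd e] @ u = map b [0..<n]" by (simp add: edge_at_def)
              let ?k = "length (fst e)"
              have k: "?k < n" using arg_cong[OF eq, of length] by simp
              have "fst e = map b [0..<?k]"
                using arg_cong[OF eq, of "take ?k"] k by (simp add: take_map)
              moreover have "snd e = b ?k" using arg_cong[OF eq, of "\<lambda>l. l ! ?k"] k by simp
              ultimately have "(fst e, snd e) = ([] @ map b [0..<?k], b ?k)"
                unfolding append_Nil prod.inject by (rule conjI)
              then have "e = edge_at [] b ?k" by (simp only: edge_at_def prod.collapse)
              then show False using e by blast
            qed
            then have "((fst e @ [snd e]) @ u, c) \<notin> range (edge_at [] b)" by blast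
            then show ?thesis by (simp add: y)
          qed
          then have "word_sum (fst e @ [snd e]) w (\<lambda>e. y e + z e) = word_sum (fst e @ [snd e]) w z" for w
            by (simp add: word_sum_def)
          then have "escapes (fst e @ [snd e]) z" using esc by (simp add: escapes_def)
          then show False using off by blast
        qed
      qed
      then show "T (\<lambda>e. y e + z e) = y" by (auto simp: T_def y)
    qed
    then have "AE z in distr M borel (\<lambda>\<omega> e. \<xi> e \<omega>). T (\<lambda>e. y e + z e) = y"
      by (simp only: standard_gaussian_family_law[OF \<xi>])
    then show ?thesis by (rule AE_distrD[OF standard_gaussian_family_measurable[OF \<xi>]])
  qed
  ultimately show ?thesis unfolding admits_recovery_def by blast
qed

section \<open>Cylinder sets and random branches\<close>

text \<open>One implication suffices, since \<open>z\<close> and \<open>z'\<close> can be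
  exchanged.\<close>

definition cylinder :: "'i set \<Rightarrow> ('i \<Rightarrow> real) set \<Rightarrow> bool" where
  "cylinder F B \<longleftrightarrow> (\<forall>z z'. (\<forall>i\<in>F. z i = z' i) \<longrightarrow> z \<in> B \<longrightarrow> z' \<in> B)"

text \<open>The sets approximable to every precision form a sigma-algebra containing the
  one-coordinate events. A single \<open>B\<close> has to serve both measures, so they are carried
  through the induction together.\<close>

lemma cylinder_approximation:
  fixes P Q :: "('i::countable \<Rightarrow> real) measure"
  assumes "finite_measure P" "finite_measure Q"
    and [measurable_cong, simp]: "sets P = sets borel" "sets Q = sets borel"
    and A: "A \<in> sets borel" and "\<epsilon> > 0"
  shows "\<exists>F B. finite F \<and> cylinder F B \<and> B \<in> sets borel \<and>
    measure P (sym_diff A B) < \<epsilon> \<and> measure Q (sym_diff A B) < \<epsilon>"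
proof -
  interpret P: finite_measure P by fact
  interpret Q: finite_measure Q by fact
  let ?G = "{{f \<in> \<Pi>\<^sub>E i\<in>UNIV. space borel. f i \<in> A} | (i::'i) A. i \<in> UNIV \<and> A \<in> sets (borel :: real measure)}"
  let ?a = "\<lambda>\<epsilon> A F B. finite F \<and> cylinder F B \<and> B \<in> sets borel \<and>
      measure P (sym_diff A B) < \<epsilon> \<and> measure Q (sym_diff A B) < \<epsilon>"
  have eq: "sets (borel :: ('i \<Rightarrow> real) measure) = sigma_sets UNIV ?G"
    using sets_PiM_single[of "UNIV :: 'i set" "\<lambda>_. borel :: real measure"] by (simp add: sets_PiM_equal_borel)
  have "A \<in> sigma_sets UNIV ?G" using A eq by simp
  \<comment> \<open>The precision is quantified inside the induction because the union step needs a
    smaller one for its members.\<close>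
  then have "\<forall>\<epsilon>>0. \<exists>F B. ?a \<epsilon> A F B"
  proof (induction rule: sigma_sets.induct)
    case (Basic A)
    then have "A \<in> sets borel" unfolding eq by (rule sigma_sets.Basic)
    moreover obtain i A' where "A = {f \<in> \<Pi>\<^sub>E i\<in>UNIV. space borel. f i \<in> A'}" using Basic by blast
    then have "cylinder {i} A" by (simp add: cylinder_def)
    ultimately show ?case by (intro allI impI exI[of _ "{i}"] exI[of _ A]) simp
  next
    case Empty
    show ?case by (intro allI impI exI[of _ "{}"] exI[of _ "{}"]) (simp add: cylinder_def)
  next
    case (Compl A)
    show ?case
    proof (intro allI impI)
      fix \<epsilon> :: real assume "\<epsilon> > 0"
      then obtain F B where FB: "?a \<epsilon> A F B" using Compl.IH by blast
      have "sym_diff (UNIV - A) (UNIV - B) = sym_diff A B" by blast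
      moreover have "cylinder F (UNIV - B)" using FB unfolding cylinder_def by (metis DiffE DiffI UNIV_I)
      moreover have "UNIV - B \<in> sets borel" using FB by (metis sets.compl_sets space_borel)
      ultimately show "\<exists>F B. ?a \<epsilon> (UNIV - A) F B" using FB by (intro exI[of _ F] exI[of _ "UNIV - B"]) simp
    qed
  next
    case (Union A)
    have [measurable]: "A i \<in> sets borel" for i using Union.hyps eq by simp
    let ?U = "\<Union>i. A i"
    let ?R = "\<lambda>N. ?U - (\<Union>i<N. A i)"
    have R [measurable]: "?R N \<in> sets borel" for N by measurable
    have lim: "(\<lambda>N. measure \<mu> (?R N)) \<longlonglongrightarrow> 0" if "finite_measure \<mu>" "sets \<mu> = sets borel" for \<mu>
    proof -
      interpret finite_measure \<mu> by fact
      have "(\<lambda>N. measure \<mu> (?R N)) \<longlonglongrightarrow> measure \<mu> (\<Inter>N. ?R N)"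
      proof (rule finite_Lim_measure_decseq)
        show "range ?R \<subseteq> sets \<mu>" unfolding that(2) using R by blast
        show "decseq ?R" unfolding decseq_def by fastforce
      qed
      moreover have "(\<Inter>N. ?R N) = {}" by auto
      ultimately show ?thesis by (simp only: measure_empty)
    qed
    show ?case
    proof (intro allI impI)
      fix \<epsilon> :: real assume e: "\<epsilon> > 0"
      then have "\<forall>\<^sub>F N in sequentially. measure P (?R N) < \<epsilon> / 2"
        by (intro order_tendstoD(2)[OF lim]) (auto simp: assms)
      moreover have "\<forall>\<^sub>F N in sequentially. measure Q (?R N) < \<epsilon> / 2"
        using e by (intro order_tendstoD(2)[OF lim]) (auto simp: assms)
      ultimately have "\<forall>\<^sub>F N in sequentially. measure P (?R N) < \<epsilon> / 2 \<and> measure Q (?R N) < \<epsilon> / 2"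
        by eventually_elim simp
      then obtain N where N: "measure P (?R N) < \<epsilon> / 2" "measure Q (?R N) < \<epsilon> / 2"
        by (auto simp: eventually_sequentially)
      \<comment> \<open>Half of \<open>\<epsilon>\<close> pays for the discarded tail of the union,
        the other half is shared by \<open>N\<close> approximations. Adding 1 covers
        \<open>N = 0\<close>.\<close>
      define \<eta> where "\<eta> = \<epsilon> / 2 / (real N + 1)"
      have \<eta>: "\<eta> > 0" "N * \<eta> \<le> \<epsilon> / 2" using e by (auto simp: \<eta>_def field_simps)
      have "\<forall>i. \<exists>F B. ?a \<eta> (A i) F B" using Union.IH \<eta>(1) by blast
      then obtain F B where FB: "\<And>i. ?a \<eta> (A i) (F i) (B i)" by metis
      then have [measurable]: "B i \<in> sets borel" for i by blast
      let ?F = "\<Union>i<N. F i" and ?B = "\<Union>i<N. B i"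
      have sub: "sym_diff ?U ?B \<subseteq> ?R N \<union> (\<Union>i<N. sym_diff (A i) (B i))" by blast
      have bound: "measure \<mu> (sym_diff ?U ?B) < \<epsilon>"
        if "finite_measure \<mu>" and [measurable_cong]: "sets \<mu> = sets borel" and "measure \<mu> (?R N) < \<epsilon> / 2"
          and le: "\<And>i. measure \<mu> (sym_diff (A i) (B i)) < \<eta>" for \<mu>
      proof -
        interpret finite_measure \<mu> by fact
        have "measure \<mu> (sym_diff ?U ?B) \<le> measure \<mu> (?R N \<union> (\<Union>i<N. sym_diff (A i) (B i)))"
          by (rule finite_measure_mono[OF sub]) measurable
        also have "\<dots> \<le> measure \<mu> (?R N) + measure \<mu> (\<Union>i<N. sym_diff (A i) (B i))"
          by (rule measure_Un_le) measurable
        also have "measure \<mu> (\<Union>i<N. sym_diff (A i) (B i)) \<le> (\<Sum>i<N. measure \<mu> (sym_diff (A i) (B i)))"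
          by (rule measure_UNION_le) (simp, measurable)
        also have "\<dots> \<le> (\<Sum>i<N. \<eta>)" by (intro sum_mono less_imp_le le)
        also have "\<dots> \<le> \<epsilon> / 2" using \<eta> by simp
        finally show ?thesis using that(3) by simp
      qed
      have "cylinder ?F ?B"
        unfolding cylinder_def
      proof safe
        fix z z' i assume *: "\<forall>i\<in>?F. z i = z' i" "z \<in> B i" "i < N"
        then have "cylinder (F i) (B i)" "\<forall>j\<in>F i. z j = z' j" using FB by auto
        then show "z' \<in> ?B" using * unfolding cylinder_def by blast
      qed
      moreover have "finite ?F" "?B \<in> sets borel" using FB by auto
      ultimately show "\<exists>F B. ?a \<epsilon> ?U F B"
        using bound[OF assms(1,3) N(1)] bound[OF assms(2,4) N(2)] FB
        by (intro exI[of _ ?F] exI[of _ ?B]) blast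
    qed
  qed
  then show ?thesis using \<open>\<epsilon> > 0\<close> by blast
qed

text \<open>Absolute continuity from a quantitative bound on cylinders: a cylinder close to a
  \<open>P\<close>-null set \<open>A\<close> has small \<open>P\<close>-measure, while its
  \<open>Q\<close>-measure stays at least half that of \<open>A\<close>.\<close>

lemma null_if_null_on_cylinders:
  fixes P Q :: "('i::countable \<Rightarrow> real) measure"
  assumes PQ: "finite_measure P" "finite_measure Q" "sets P = sets borel" "sets Q = sets borel"
    and K: "K \<ge> 0"
    and bound: "\<And>F B. finite F \<Longrightarrow> cylinder F B \<Longrightarrow> B \<in> sets borel \<Longrightarrow> (measure Q B)\<^sup>2 \<le> K * measure P B"
    and A: "A \<in> sets borel" "measure P A = 0"
  shows "measure Q A = 0"
proof (rule ccontr)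
  interpret P: finite_measure P by fact
  interpret Q: finite_measure Q by fact
  assume "measure Q A \<noteq> 0"
  define q where "q = measure Q A"
  have q: "q > 0" using \<open>measure Q A \<noteq> 0\<close> by (simp add: q_def zero_less_measure_iff)
  \<comment> \<open>The first entry keeps \<open>measure Q B\<close> above \<open>q / 2\<close>, the
    second makes \<open>K * \<epsilon>\<close> smaller than \<open>q^2 / 4\<close>;
    \<open>K + 1\<close> gives strictness and a nonzero denominator.\<close>
  define \<epsilon> where "\<epsilon> = min (q / 2) (q\<^sup>2 / (4 * (K + 1)))"
  have e: "\<epsilon> > 0" "\<epsilon> \<le> q / 2" "\<epsilon> \<le> q\<^sup>2 / (4 * (K + 1))"
    unfolding \<epsilon>_def using q K by (simp, intro min.cobounded1, intro min.cobounded2)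
  obtain F B where FB: "finite F" "cylinder F B" and B: "B \<in> sets borel"
    and d: "measure P (sym_diff A B) < \<epsilon>" "measure Q (sym_diff A B) < \<epsilon>"
    using cylinder_approximation[OF PQ A(1) e(1)] by blast
  have "measure Q A \<le> measure Q (B \<union> sym_diff A B)"
    using A B PQ by (intro Q.finite_measure_mono) auto
  also have "\<dots> \<le> measure Q B + measure Q (sym_diff A B)"
    using A B PQ by (intro measure_Un_le) auto
  finally have "q / 2 \<le> measure Q B" using d e by (simp add: q_def)
  then have "(q / 2)\<^sup>2 \<le> (measure Q B)\<^sup>2" using q by (intro power_mono) auto
  also have "\<dots> \<le> K * measure P B" using FB B by (rule bound)
  also have "measure P B \<le> \<epsilon>"
  proof -
    have "measure P B \<le> measure P (A \<union> sym_diff A B)"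
      using A B PQ by (intro P.finite_measure_mono) auto
    also have "\<dots> \<le> measure P A + measure P (sym_diff A B)"
      using A B PQ by (intro measure_Un_le) auto
    finally show ?thesis using d A(2) by simp
  qed
  then have "K * measure P B \<le> K * (q\<^sup>2 / (4 * (K + 1)))" using K e by (intro mult_left_mono) auto
  also have "\<dots> < (q / 2)\<^sup>2" using K q by (simp add: field_simps power2_eq_square)
  finally show False by simp
qed

section \<open>Uniformly random branches\<close>

definition coins :: "(nat \<Rightarrow> bool) measure" where
  "coins = PiM UNIV (\<lambda>_. measure_pmf (bernoulli_pmf (1/2)))"

lemma space_coins [simp]: "space coins = UNIV"
  by (simp add: coins_def space_PiM PiE_def)

lemma prob_space_coins: "prob_space coins"
  unfolding coins_def by (intro prob_space_PiM measure_pmf.prob_space_axioms)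

lemma measurable_coin [measurable]: "(\<lambda>b. b i) \<in> coins \<rightarrow>\<^sub>M count_space UNIV"
proof -
  have "(\<lambda>b. b i) \<in> coins \<rightarrow>\<^sub>M measure_pmf (bernoulli_pmf (1/2))"
    unfolding coins_def by (rule measurable_component_singleton) simp
  then show ?thesis by (simp cong: measurable_cong_sets)
qed

text \<open>This is the chance that a random branch shares its first \<open>k\<close> edges with a
  given one, the decay that beats the correlations in the second moment.\<close>

lemma emeasure_coins_prefix: "emeasure coins {b'. \<forall>i<k. b' i = b i} = ennreal ((1/2) ^ k)"
proof -
  interpret product_prob_space "\<lambda>_::nat. measure_pmf (bernoulli_pmf (1/2))" UNIV
    by (intro product_prob_spaceI measure_pmf.prob_space_axioms)
  have "{b'. \<forall>i<k. b' i = b i} =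
      prod_emb UNIV (\<lambda>_. measure_pmf (bernoulli_pmf (1/2))) {..<k} (\<Pi>\<^sub>E i\<in>{..<k}. {b i})"
    by (rule set_eqI, unfold prod_emb_iff PiE_iff) auto
  also have "emeasure coins \<dots> = (\<Prod>i<k. emeasure (measure_pmf (bernoulli_pmf (1/2))) {b i})"
    unfolding coins_def by (rule emeasure_PiM_emb) auto
  also have "\<dots> = (\<Prod>i<k. ennreal (1/2))"
  proof (intro prod.cong refl)
    show "emeasure (measure_pmf (bernoulli_pmf (1/2))) {b i} = ennreal (1/2)" for i
      by (cases "b i") (simp_all add: emeasure_pmf_single)
  qed
  also have "\<dots> = ennreal ((1/2) ^ k)" by (subst prod_ennreal) auto
  finally show ?thesis .
qed

text \<open>Edges are countable, so single edges suffice, and the preimage of one is a condition on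
  finitely many coins.\<close>

lemma measurable_edge_at [measurable]: "(\<lambda>b. edge_at v b i) \<in> coins \<rightarrow>\<^sub>M count_space UNIV"
proof (subst measurable_count_space_eq2_countable, safe)
  fix u c
  have "(\<lambda>b. edge_at v b i) -` {(u, c)} = {b. length u = length v + i \<and> (\<forall>j<length v. v ! j = u ! j) \<and>
      (\<forall>j<i. b j = u ! (length v + j)) \<and> b i = c}"
    by (auto simp: edge_at_def list_eq_iff_nth_eq nth_append)
  also have "\<dots> \<in> sets coins"
  proof -
    have "{b \<in> space coins. length u = length v + i \<and> (\<forall>j<length v. v ! j = u ! j) \<and>
      (\<forall>j<i. b j = u ! (length v + j)) \<and> b i = c} \<in> sets coins" by measurable
    then show ?thesis by simp
  qed
  finally show "(\<lambda>b. edge_at v b i) -` {(u, c)} \<inter> space coins \<in> sets coins" by simp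
qed auto

lemma measurable_white_coordinate: "(\<lambda>z. z i) \<in> borel_measurable white"
  by simp

definition branch_sum :: "(nat \<Rightarrow> bool) \<Rightarrow> nat \<Rightarrow> (edge \<Rightarrow> real) \<Rightarrow> real" where
  "branch_sum b n z = (\<Sum>i<n. z (edge_at [] b i))"

lemma branch_sum_measurable [measurable]:
  "(\<lambda>x. branch_sum (fst x) n (snd x)) \<in> borel_measurable (coins \<Otimes>\<^sub>M white)"
  "branch_sum b n \<in> borel_measurable borel"
proof -
  \<comment> \<open>The noise is evaluated at a random edge; joint measurability holds because that
    edge takes countably many values.\<close>
  have "(\<lambda>x. (snd x) (edge_at [] (fst x) i)) \<in> borel_measurable (coins \<Otimes>\<^sub>M white)" for i
    by (rule measurable_compose_countable[where f = "\<lambda>e x. snd x e"])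
       (rule measurable_compose[OF measurable_snd measurable_white_coordinate],
        rule measurable_compose[OF measurable_fst measurable_edge_at])
  then show "(\<lambda>x. branch_sum (fst x) n (snd x)) \<in> borel_measurable (coins \<Otimes>\<^sub>M white)"
    unfolding branch_sum_def by measurable
  show "branch_sum b n \<in> borel_measurable borel" unfolding branch_sum_def by measurable
qed

section \<open>Non-detection\<close>

text \<open>Density with respect to \<open>white\<close> of noise with signal on the first
  \<open>n\<close> edges of \<open>b\<close>, restricted to good noise. In terms of the observation
  the barrier \<open>c * k + C\<close> for the noise becomes
  \<open>(\<delta> + c) * k + C\<close>.\<close>

definition trunc_density ::
    "real \<Rightarrow> real \<Rightarrow> real \<Rightarrow> nat \<Rightarrow> (nat \<Rightarrow> bool) \<Rightarrow> (edge \<Rightarrow> real) \<Rightarrow> ennreal" where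
  "trunc_density \<delta> c C n b z =
    (if \<forall>k\<in>{..n}. branch_sum b k z \<le> (\<delta> + c) * k + C
     then ennreal (exp (\<delta> * branch_sum b n z - n * \<delta>\<^sup>2 / 2)) else 0)"

lemma trunc_density_measurable [measurable]:
  "(\<lambda>x. trunc_density \<delta> c C n (fst x) (snd x)) \<in> borel_measurable (coins \<Otimes>\<^sub>M white)"
  "trunc_density \<delta> c C n b \<in> borel_measurable borel"
  unfolding trunc_density_def by measurable

lemma trunc_density_measurable_branch [measurable]:
  "(\<lambda>b. trunc_density \<delta> c C n b z) \<in> borel_measurable coins"
  using measurable_compose[OF measurable_Pair2'[of z white coins] trunc_density_measurable(1)] by simp

lemma trunc_density_mean_measurable:
  "(\<lambda>z. \<integral>\<^sup>+b. trunc_density \<delta> c C n b z \<partial>coins) \<in> borel_measurable white"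
proof (rule sigma_finite_measure.borel_measurable_nn_integral)
  show "sigma_finite_measure coins" by (intro prob_space_imp_sigma_finite prob_space_coins)
  show "(\<lambda>(z, b). trunc_density \<delta> c C n b z) \<in> borel_measurable (white \<Otimes>\<^sub>M coins)"
    using measurable_pair_swap[OF trunc_density_measurable(1)] by simp
qed

lemma coins_white: "pair_sigma_finite coins white"
  by (intro pair_sigma_finite.intro prob_space_imp_sigma_finite prob_space_coins prob_space_white)

text \<open>The exponential of \<open>\<delta> ((\<delta> + c) k + C - S\<^sub>k)\<close> dominates the truncation at the splitting level \<open>k\<close>
  and cancels the double count of the shared edges.\<close>

lemma trunc_density_pair:
  assumes d: "\<delta> > 0"
  shows "(\<integral>\<^sup>+z. trunc_density \<delta> c C n b z * trunc_density \<delta> c C n b' z \<partial>white) \<le>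
    (\<Sum>k\<le>n. ennreal (exp (real k * (\<delta>\<^sup>2 / 2 + \<delta> * c) + \<delta> * C)) * indicator {b'. \<forall>i<k. b' i = b i} b')"
proof -
  \<comment> \<open>\<open>k\<close> is the number of edges that the two branches share among their
    first \<open>n\<close>.\<close>
  obtain k where k: "k \<le> n" "\<forall>i<k. b' i = b i" "k = n \<or> b' k \<noteq> b k"
  proof (cases "\<forall>i<n. b' i = b i")
    case False
    let ?k = "LEAST i. b' i \<noteq> b i"
    obtain i where i: "i < n" "b' i \<noteq> b i" using False by blast
    have "?k \<le> i" using i(2) by (rule Least_le)
    then have le: "?k \<le> n" using i(1) by simp
    have ne: "b' ?k \<noteq> b ?k" by (rule LeastI[of "\<lambda>i. b' i \<noteq> b i", OF i(2)])
    have "\<forall>i<?k. b' i = b i" using not_less_Least by blast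
    then show ?thesis by (rule that[OF le _ disjI2[OF ne]])
  qed (use that in blast)
  define E where "E b = edge_at [] b ` {..<n}" for b
  let ?U = "E b \<union> E b'"
  have inj: "inj_on (edge_at [] b) A" for b A using inj_edge_at by (rule inj_on_subset) simp
  have I: "E b \<inter> E b' = edge_at [] b ` {..<k}"
  proof (intro equalityI subsetI)
    fix e assume "e \<in> E b \<inter> E b'"
    then obtain i where i: "i < n" "e = edge_at [] b i" "\<forall>j\<le>i. b j = b' j"
      by (auto simp: E_def edge_at_eq_iff)
    then have "i < k" using k(3) by (metis not_le)
    then show "e \<in> edge_at [] b ` {..<k}" using i by blast
  next
    fix e assume "e \<in> edge_at [] b ` {..<k}"
    then obtain i where i: "i < k" "e = edge_at [] b i" by blast
    then have "e = edge_at [] b' i" using k(2) by (auto simp: edge_at_eq_iff)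
    then show "e \<in> E b \<inter> E b'" using i k(1) unfolding E_def
      by (intro IntI image_eqI[of _ _ i]) auto
  qed
  have finE: "finite (E b)" for b by (simp add: E_def)
  have sumE: "(\<Sum>e\<in>edge_at [] b ` {..<m}. z e) = branch_sum b m z" for b m and z :: "edge \<Rightarrow> real"
    unfolding branch_sum_def by (subst sum.reindex[OF inj]) simp
  have sumU: "(\<Sum>e\<in>?U. z e) = branch_sum b n z + branch_sum b' n z - branch_sum b k z" for z
    using sum.union_inter[OF finE finE, of z b b'] unfolding I by (simp add: sumE E_def)
  have cardU: "real (card ?U) = 2 * real n - real k"
    using card_Un_Int[OF finE finE, of b b'] k(1) unfolding I by (simp add: E_def card_image[OF inj])
  \<comment> \<open>The two normalizing factors contribute \<open>- n * \<delta>^2\<close>, the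
    barrier at level \<open>k\<close> the rest. With \<open>2 * n - k\<close> edges in the union the
    terms in \<open>n\<close> cancel after integration.\<close>
  let ?a = "\<delta> * ((\<delta> + c) * k + C) - n * \<delta>\<^sup>2"
  have "(\<integral>\<^sup>+z. trunc_density \<delta> c C n b z * trunc_density \<delta> c C n b' z \<partial>white)
      \<le> (\<integral>\<^sup>+z. ennreal (exp ?a) * ennreal (exp (\<delta> * (\<Sum>e\<in>?U. z e))) \<partial>white)"
  proof (rule nn_integral_mono)
    fix z
    show "trunc_density \<delta> c C n b z * trunc_density \<delta> c C n b' z \<le> ennreal (exp ?a) * ennreal (exp (\<delta> * (\<Sum>e\<in>?U. z e)))"
    proof (cases "branch_sum b k z \<le> (\<delta> + c) * k + C")
      case True
      let ?x = "\<delta> * branch_sum b n z - n * \<delta>\<^sup>2 / 2" and ?y = "\<delta> * branch_sum b' n z - n * \<delta>\<^sup>2 / 2"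
      have "trunc_density \<delta> c C n b z * trunc_density \<delta> c C n b' z \<le> ennreal (exp ?x) * ennreal (exp ?y)"
        unfolding trunc_density_def by (intro mult_mono) auto
      also have "\<dots> = ennreal (exp (?x + ?y))"
        by (simp only: exp_add ennreal_mult'' exp_ge_zero)
      also have "\<dots> \<le> ennreal (exp (?a + \<delta> * (\<Sum>e\<in>?U. z e)))"
      proof -
        have "\<delta> * branch_sum b k z \<le> \<delta> * ((\<delta> + c) * k + C)" using True d by (intro mult_left_mono) auto
        then show ?thesis unfolding sumU by (intro ennreal_leI) (simp add: algebra_simps)
      qed
      also have "\<dots> = ennreal (exp ?a) * ennreal (exp (\<delta> * (\<Sum>e\<in>?U. z e)))"
        by (simp only: exp_add ennreal_mult'' exp_ge_zero)
      finally show ?thesis .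
    next
      case False
      then have "trunc_density \<delta> c C n b z = 0" using k(1) unfolding trunc_density_def by auto
      then show ?thesis by simp
    qed
  qed
  also have "\<dots> = ennreal (exp ?a) * ennreal (exp (card ?U * \<delta>\<^sup>2 / 2))"
    by (subst nn_integral_cmult) (simp_all add: nn_integral_white_exp finE)
  also have "\<dots> = ennreal (exp (real k * (\<delta>\<^sup>2 / 2 + \<delta> * c) + \<delta> * C))"
    unfolding cardU by (simp add: ennreal_mult''[symmetric] exp_add[symmetric] power2_eq_square field_simps)
  also have "\<dots> = ennreal (exp (real k * (\<delta>\<^sup>2 / 2 + \<delta> * c) + \<delta> * C)) * indicator {b'. \<forall>i<k. b' i = b i} b'"
    using k(2) by simp
  \<comment> \<open>Summing over all levels removes the dependence of \<open>k\<close> on the two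
    branches, so each term can be integrated over \<open>b'\<close> separately.\<close>
  also have "\<dots> \<le> (\<Sum>k\<le>n. ennreal (exp (real k * (\<delta>\<^sup>2 / 2 + \<delta> * c) + \<delta> * C)) * indicator {b'. \<forall>i<k. b' i = b i} b')"
    using k(1) by (intro member_le_sum) auto
  finally show ?thesis .
qed

text \<open>The square of the mean is an integral over two independent branches. Integrating out the
  noise first reduces it to their overlap, which gives a geometric series whose bound does not
  depend on \<open>n\<close>.\<close>

lemma trunc_density_second_moment:
  assumes d: "\<delta> > 0" and r: "\<delta>\<^sup>2 / 2 + \<delta> * c < ln 2"
  shows "(\<integral>\<^sup>+z. (\<integral>\<^sup>+b. trunc_density \<delta> c C n b z \<partial>coins)\<^sup>2 \<partial>white)
    \<le> ennreal (exp (\<delta> * C) / (1 - exp (\<delta>\<^sup>2 / 2 + \<delta> * c) / 2))"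
proof -
  interpret pair_sigma_finite coins white by (rule coins_white)
  interpret coins: prob_space coins by (rule prob_space_coins)
  let ?D = "trunc_density \<delta> c C n"
  define W where "W z = (\<integral>\<^sup>+b. ?D b z \<partial>coins)" for z
  have D2 [measurable]: "(\<lambda>(b, z). ?D b z) \<in> borel_measurable (coins \<Otimes>\<^sub>M white)"
    using trunc_density_measurable(1)[of \<delta> c C n] by (simp add: case_prod_beta)
  have W [measurable]: "W \<in> borel_measurable white"
    unfolding W_def by (rule trunc_density_mean_measurable)
  let ?e = "\<lambda>k::nat. exp (k * (\<delta>\<^sup>2 / 2 + \<delta> * c) + \<delta> * C)"
  \<comment> \<open>The ratio combines the growth per shared edge with the probability 1/2 of
    sharing it; assumption \<open>r\<close> says exactly that \<open>q < 1\<close>.\<close>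
  define q where "q = exp (\<delta>\<^sup>2 / 2 + \<delta> * c) / 2"
  have q: "0 \<le> q" "q < 1" using r by (auto simp: q_def) (metis exp_less_cancel_iff exp_ln zero_less_numeral)
  have prefix [measurable]: "{b'. \<forall>i<k. b' i = b i} \<in> sets coins" for k b
  proof -
    have "{b' \<in> space coins. \<forall>i<k. b' i = b i} \<in> sets coins" by measurable
    then show ?thesis by simp
  qed
  have "(\<integral>\<^sup>+z. (W z)\<^sup>2 \<partial>white) = (\<integral>\<^sup>+z. \<integral>\<^sup>+b. ?D b z * W z \<partial>coins \<partial>white)"
    by (simp add: nn_integral_multc W_def power2_eq_square)
  also have "\<dots> = (\<integral>\<^sup>+b. \<integral>\<^sup>+z. ?D b z * W z \<partial>white \<partial>coins)"
    by (rule Fubini') measurable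
  also have "\<dots> = (\<integral>\<^sup>+b. \<integral>\<^sup>+z. \<integral>\<^sup>+b'. ?D b z * ?D b' z \<partial>coins \<partial>white \<partial>coins)"
    by (simp add: nn_integral_cmult W_def)
  also have "\<dots> = (\<integral>\<^sup>+b. \<integral>\<^sup>+b'. \<integral>\<^sup>+z. ?D b z * ?D b' z \<partial>white \<partial>coins \<partial>coins)"
    by (intro nn_integral_cong Fubini') measurable
  also have "\<dots> \<le> (\<integral>\<^sup>+b. \<integral>\<^sup>+b'. (\<Sum>k\<le>n. ennreal (?e k) * indicator {b'. \<forall>i<k. b' i = b i} b') \<partial>coins \<partial>coins)"
    by (rule nn_integral_mono, rule nn_integral_mono, rule trunc_density_pair[OF d])
  also have "\<dots> = (\<integral>\<^sup>+b. (\<Sum>k\<le>n. ennreal (exp (\<delta> * C) * q ^ k)) \<partial>coins)"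
  proof (intro nn_integral_cong)
    fix b
    have "(\<integral>\<^sup>+b'. (\<Sum>k\<le>n. ennreal (?e k) * indicator {b'. \<forall>i<k. b' i = b i} b') \<partial>coins)
        = (\<Sum>k\<le>n. ennreal (?e k) * ennreal ((1/2) ^ k))"
      by (subst nn_integral_sum) (simp_all add: nn_integral_cmult_indicator emeasure_coins_prefix)
    also have "\<dots> = (\<Sum>k\<le>n. ennreal (exp (\<delta> * C) * q ^ k))"
    proof (intro sum.cong refl)
      fix k
      have "?e k * (1/2) ^ k = exp (\<delta> * C) * q ^ k"
        unfolding q_def by (simp add: exp_add exp_of_nat_mult power_divide)
      then show "ennreal (?e k) * ennreal ((1/2) ^ k) = ennreal (exp (\<delta> * C) * q ^ k)"
        by (simp add: ennreal_mult''[symmetric])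
    qed
    finally show "(\<integral>\<^sup>+b'. (\<Sum>k\<le>n. ennreal (?e k) * indicator {b'. \<forall>i<k. b' i = b i} b') \<partial>coins)
      = (\<Sum>k\<le>n. ennreal (exp (\<delta> * C) * q ^ k))" .
  qed
  also have "\<dots> = (\<Sum>k\<le>n. ennreal (exp (\<delta> * C) * q ^ k))"
    using coins.emeasure_space_1 by simp
  also have "\<dots> = ennreal (\<Sum>k\<le>n. exp (\<delta> * C) * q ^ k)" using q by (intro sum_ennreal) simp
  also have "\<dots> \<le> ennreal (exp (\<delta> * C) / (1 - q))"
  proof (rule ennreal_leI)
    have s: "(\<lambda>k. exp (\<delta> * C) * q ^ k) sums (exp (\<delta> * C) * (1 / (1 - q)))"
      using q by (intro sums_mult geometric_sums) auto
    then have "(\<Sum>k\<le>n. exp (\<delta> * C) * q ^ k) \<le> (\<Sum>k. exp (\<delta> * C) * q ^ k)"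
      using q by (intro sum_le_suminf) (auto simp: sums_iff)
    then show "(\<Sum>k\<le>n. exp (\<delta> * C) * q ^ k) \<le> exp (\<delta> * C) / (1 - q)" using s by (simp add: sums_iff)
  qed
  finally show ?thesis by (simp add: W_def q_def)
qed

section \<open>The planted law and its comparison with pure noise\<close>

text \<open>The barrier is imposed on the noise along the whole branch, before the signal is added.
  It acts as a density and is not normalized, so the total mass may be below 1.\<close>

definition planted :: "real \<Rightarrow> real \<Rightarrow> real \<Rightarrow> (edge \<Rightarrow> real) measure" where
  "planted \<delta> c C = distr
    (density (coins \<Otimes>\<^sub>M white) (\<lambda>x. if \<forall>k. branch_sum (fst x) k (snd x) \<le> c * k + C then 1 else 0))
    borel (\<lambda>x e. \<delta> * indicator (range (edge_at [] (fst x))) e + snd x e)"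

lemma sets_planted [simp]: "sets (planted \<delta> c C) = sets borel"
  by (simp add: planted_def)

lemma emeasure_planted:
  assumes B: "B \<in> sets borel"
  shows "emeasure (planted \<delta> c C) B =
    (\<integral>\<^sup>+b. \<integral>\<^sup>+z. (if \<forall>k. branch_sum b k z \<le> c * k + C then 1 else 0) *
      indicator B (\<lambda>e. \<delta> * indicator (range (edge_at [] b)) e + z e) \<partial>white \<partial>coins)"
proof -
  interpret pair_sigma_finite coins white by (rule coins_white)
  let ?\<Phi> = "\<lambda>(x :: (nat \<Rightarrow> bool) \<times> (edge \<Rightarrow> real)) e. \<delta> * indicator (range (edge_at [] (fst x))) e + snd x e"
  let ?G = "\<lambda>(x :: (nat \<Rightarrow> bool) \<times> (edge \<Rightarrow> real)). if \<forall>k. branch_sum (fst x) k (snd x) \<le> c * k + C then 1 else 0 :: ennreal"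
  have G [measurable]: "?G \<in> borel_measurable (coins \<Otimes>\<^sub>M white)" by measurable
  have \<Phi>: "?\<Phi> \<in> borel_measurable (coins \<Otimes>\<^sub>M white)"
  proof (rule measurable_coordinatewise_then_product)
    fix e
    \<comment> \<open>Membership of \<open>e\<close> in the branch is a countable disjunction of
      measurable conditions.\<close>
    have "(\<lambda>b. indicator (range (edge_at [] b)) e :: real) = (\<lambda>b. if \<exists>i. edge_at [] b i = e then 1 else 0)"
      by (auto simp: fun_eq_iff indicator_def)
    also have "\<dots> \<in> borel_measurable coins" by measurable
    finally have 1: "(\<lambda>x. indicator (range (edge_at [] (fst x))) e :: real) \<in> borel_measurable (coins \<Otimes>\<^sub>M white)"
      by (rule measurable_compose[OF measurable_fst])
    have 2: "(\<lambda>x. snd x e) \<in> borel_measurable (coins \<Otimes>\<^sub>M white)"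
      by (rule measurable_compose[OF measurable_snd measurable_white_coordinate])
    show "(\<lambda>x. ?\<Phi> x e) \<in> borel_measurable (coins \<Otimes>\<^sub>M white)"
      by (intro borel_measurable_add borel_measurable_times 1 2) simp
  qed
  have BI: "(\<lambda>x. indicator B (?\<Phi> x) :: ennreal) \<in> borel_measurable (coins \<Otimes>\<^sub>M white)"
    by (rule measurable_compose[OF \<Phi>]) (use B in simp)
  have "emeasure (planted \<delta> c C) B = (\<integral>\<^sup>+z. indicator B z \<partial>planted \<delta> c C)"
    by (rule nn_integral_indicator[symmetric]) (simp add: B)
  also have "\<dots> = (\<integral>\<^sup>+x. indicator B (?\<Phi> x) \<partial>density (coins \<Otimes>\<^sub>M white) ?G)"
  proof -
    have "?\<Phi> \<in> borel_measurable (density (coins \<Otimes>\<^sub>M white) ?G)"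
      using \<Phi> measurable_cong_sets[OF sets_density refl] by blast
    then show ?thesis unfolding planted_def by (rule nn_integral_distr) (use B in simp)
  qed
  also have "\<dots> = (\<integral>\<^sup>+x. ?G x * indicator B (?\<Phi> x) \<partial>(coins \<Otimes>\<^sub>M white))"
    by (rule nn_integral_density[OF G BI])
  also have "\<dots> = (\<integral>\<^sup>+b. \<integral>\<^sup>+z. ?G (b, z) * indicator B (?\<Phi> (b, z)) \<partial>white \<partial>coins)"
    by (rule M2.nn_integral_fst[symmetric, OF borel_measurable_times_ennreal[OF G BI]])
  finally show ?thesis by simp
qed

lemma finite_measure_planted: "finite_measure (planted \<delta> c C)"
proof
  have "emeasure (planted \<delta> c C) UNIV \<le> (\<integral>\<^sup>+b. \<integral>\<^sup>+z. 1 \<partial>(white :: (edge \<Rightarrow> real) measure) \<partial>coins)"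
    unfolding emeasure_planted[OF sets.top[of borel, unfolded space_borel]]
    by (intro nn_integral_mono) auto
  also have "\<dots> = 1"
    using prob_space.emeasure_space_1[OF prob_space_coins] prob_space.emeasure_space_1[OF prob_space_white[where 'a = edge]] by simp
  finally show "emeasure (planted \<delta> c C) (space (planted \<delta> c C)) \<noteq> \<infinity>"
    by (auto simp: planted_def top_unique)
qed

text \<open>For a cylinder only finitely many levels matter: the signal can be cut off there and the
  barrier relaxed to those levels. The planted mass is then at most the integral of the mean density
  over \<open>B\<close>, and Cauchy-Schwarz with the second moment bound finishes.\<close>

lemma planted_cylinder:
  assumes d: "\<delta> > 0" and r: "\<delta>\<^sup>2 / 2 + \<delta> * c < ln 2"
    and F: "finite F" "cylinder F B" and B [measurable]: "B \<in> sets borel"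
  shows "(measure (planted \<delta> c C) B)\<^sup>2 \<le> exp (\<delta> * C) / (1 - exp (\<delta>\<^sup>2 / 2 + \<delta> * c) / 2) * measure white B"
proof -
  interpret pair_sigma_finite coins white by (rule coins_white)
  interpret white: prob_space "white :: (edge \<Rightarrow> real) measure" by (rule prob_space_white)
  interpret planted: finite_measure "planted \<delta> c C" by (rule finite_measure_planted)
  define K where "K = exp (\<delta> * C) / (1 - exp (\<delta>\<^sup>2 / 2 + \<delta> * c) / 2)"
  have "exp (\<delta>\<^sup>2 / 2 + \<delta> * c) < 2" using r by (metis exp_less_cancel_iff exp_ln zero_less_numeral)
  then have K: "K \<ge> 0" by (simp add: K_def)
  \<comment> \<open>Deeper than every edge of \<open>F\<close>, so that cutting the signal off at
    \<open>n\<close> does not change the coordinates in \<open>F\<close>.\<close>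
  obtain n where n: "\<And>e. e \<in> F \<Longrightarrow> length (fst e) < n"
  proof -
    have "finite ((\<lambda>e. length (fst e)) ` F)" using F(1) by simp
    then show ?thesis using that by (auto simp: finite_nat_set_iff_bounded)
  qed
  let ?D = "trunc_density \<delta> c C n"
  have D2 [measurable]: "(\<lambda>(b, z). ?D b z) \<in> borel_measurable (coins \<Otimes>\<^sub>M white)"
    using trunc_density_measurable(1)[of \<delta> c C n] by (simp add: case_prod_beta)
  have le: "(\<integral>\<^sup>+z. (if \<forall>k. branch_sum b k z \<le> c * k + C then 1 else 0) *
      indicator B (\<lambda>e. \<delta> * indicator (range (edge_at [] b)) e + z e) \<partial>white)
    \<le> (\<integral>\<^sup>+z. ?D b z * indicator B z \<partial>white)" (is "?L \<le> ?R") for b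
  proof -
    let ?F = "edge_at [] b ` {..<n}"
    let ?y = "\<lambda>e. \<delta> * indicator ?F e"
    define h :: "(edge \<Rightarrow> real) \<Rightarrow> ennreal" where
      "h z = (if \<forall>k\<in>{..n}. branch_sum b k z \<le> (\<delta> + c) * k + C then 1 else 0) * indicator B z" for z
    have h [measurable]: "h \<in> borel_measurable borel" unfolding h_def by measurable
    have sub: "?F \<subseteq> range (edge_at [] b)" by blast
    have "?L \<le> (\<integral>\<^sup>+z. h (\<lambda>e. ?y e + z e) \<partial>white)"
    proof (rule nn_integral_mono)
      fix z :: "edge \<Rightarrow> real"
      let ?z = "\<lambda>e. ?y e + z e" and ?z' = "\<lambda>e. \<delta> * indicator (range (edge_at [] b)) e + z e"
      have "h ?z = 1" if good: "\<forall>k. branch_sum b k z \<le> c * k + C" and B': "?z' \<in> B"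
      proof -
        \<comment> \<open>The signal raises the sum by \<open>\<delta>\<close> per edge, which
          accounts for the slope \<open>\<delta> + c\<close>.\<close>
        have "branch_sum b k ?z = \<delta> * k + branch_sum b k z" if "k \<le> n" for k
        proof -
          have "branch_sum b k ?z = (\<Sum>i<k. \<delta> + z (edge_at [] b i))"
            unfolding branch_sum_def
          proof (intro sum.cong refl)
            fix i assume "i \<in> {..<k}"
            then have "edge_at [] b i \<in> ?F" using that by (intro imageI) auto
            then show "?y (edge_at [] b i) + z (edge_at [] b i) = \<delta> + z (edge_at [] b i)" by simp
          qed
          then show ?thesis by (simp add: sum.distrib branch_sum_def)
        qed
        then have "\<forall>k\<in>{..n}. branch_sum b k ?z \<le> (\<delta> + c) * k + C"
          using good by (auto simp: algebra_simps)
        moreover have "?z \<in> B"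
        proof -
          have eq: "?z' e = ?z e" if "e \<in> F" for e
          proof -
            have "e \<in> ?F" if "e = edge_at [] b i" for i
              using n[OF \<open>e \<in> F\<close>] that by (auto simp: edge_at_def)
            then have "e \<in> range (edge_at [] b) \<longleftrightarrow> e \<in> ?F" by blast
            then show ?thesis by (simp add: indicator_def)
          qed
          from F(2)[unfolded cylinder_def, rule_format, OF _ B', of ?z, OF eq] show ?thesis .
        qed
        ultimately show ?thesis by (simp add: h_def)
      qed
      then show "(if \<forall>k. branch_sum b k z \<le> c * k + C then 1 else 0) * indicator B ?z' \<le> h ?z"
        by (auto simp: indicator_def)
    qed
    also have "\<dots> = (\<integral>\<^sup>+z. h z * ennreal (exp (\<Sum>e\<in>?F. ?y e * z e - (?y e)\<^sup>2 / 2)) \<partial>white)"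
      by (rule nn_integral_white_shift) auto
    also have "\<dots> = ?R"
    proof (rule nn_integral_cong)
      fix z :: "edge \<Rightarrow> real"
      have "(\<Sum>e\<in>?F. ?y e * z e - (?y e)\<^sup>2 / 2) = (\<Sum>e\<in>?F. \<delta> * z e - \<delta>\<^sup>2 / 2)"
        by (intro sum.cong) auto
      also have "\<dots> = (\<Sum>i<n. \<delta> * z (edge_at [] b i) - \<delta>\<^sup>2 / 2)"
        by (subst sum.reindex) (auto intro: inj_on_subset[OF inj_edge_at])
      also have "\<dots> = \<delta> * branch_sum b n z - n * \<delta>\<^sup>2 / 2"
        by (simp add: sum_subtractf sum_distrib_left branch_sum_def)
      finally show "h z * ennreal (exp (\<Sum>e\<in>?F. ?y e * z e - (?y e)\<^sup>2 / 2)) = ?D b z * indicator B z"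
        by (auto simp: h_def trunc_density_def mult.commute)
    qed
    finally show ?thesis .
  qed
  let ?W = "\<lambda>z. \<integral>\<^sup>+b. ?D b z \<partial>coins"
  have W: "?W \<in> borel_measurable white"
    by (rule trunc_density_mean_measurable)
  have "emeasure (planted \<delta> c C) B \<le> (\<integral>\<^sup>+b. \<integral>\<^sup>+z. ?D b z * indicator B z \<partial>white \<partial>coins)"
    unfolding emeasure_planted[OF B] by (intro nn_integral_mono le)
  also have "\<dots> = (\<integral>\<^sup>+z. \<integral>\<^sup>+b. ?D b z * indicator B z \<partial>coins \<partial>white)"
    by (rule Fubini'[symmetric]) measurable
  also have "\<dots> = (\<integral>\<^sup>+z. ?W z * indicator B z \<partial>white)"
    by (intro nn_integral_cong nn_integral_multc trunc_density_measurable_branch)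
  finally have "(emeasure (planted \<delta> c C) B)\<^sup>2 \<le> (\<integral>\<^sup>+z. ?W z * indicator B z \<partial>white)\<^sup>2"
    by (intro power_mono) auto
  also have "\<dots> \<le> (\<integral>\<^sup>+z. (?W z)\<^sup>2 \<partial>white) * (\<integral>\<^sup>+z. (indicator B z)\<^sup>2 \<partial>white)"
    by (rule Cauchy_Schwarz_nn_integral[OF W]) measurable
  also have "(\<integral>\<^sup>+z. (indicator B z)\<^sup>2 \<partial>white) = (\<integral>\<^sup>+z. indicator B z \<partial>white)"
    by (intro nn_integral_cong) (simp add: indicator_def)
  also have "\<dots> = emeasure white B" by simp
  also have "(\<integral>\<^sup>+z. (?W z)\<^sup>2 \<partial>white) \<le> ennreal K"
    unfolding K_def by (rule trunc_density_second_moment[OF d r])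
  finally have "(emeasure (planted \<delta> c C) B)\<^sup>2 \<le> ennreal K * emeasure white B"
    by (simp add: mult_right_mono)
  then have "ennreal ((measure (planted \<delta> c C) B)\<^sup>2) \<le> ennreal (K * measure white B)"
    using K by (simp add: planted.emeasure_eq_measure white.emeasure_eq_measure ennreal_power ennreal_mult)
  then show ?thesis
    unfolding K_def[symmetric] using K by (subst (asm) ennreal_le_iff) auto
qed

text \<open>The set where the test reports a signal is null for pure noise, hence for the planted
  law. Yet success on every branch would give it the full planted mass, which is positive.\<close>

lemma no_detection_subcritical:
  assumes \<xi>: "standard_gaussian_family M \<xi>" and d: "\<delta> > 0" "\<delta> < sqrt (2 * ln 2)"
  shows "\<not> admits_detection M \<xi> (scaled \<delta> branch_vectors)"
proof
  assume "admits_detection M \<xi> (scaled \<delta> branch_vectors)"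
  then obtain T :: "(edge \<Rightarrow> real) \<Rightarrow> nat" where T: "T \<in> borel \<rightarrow>\<^sub>M count_space {0, 1}"
    and T0: "AE \<omega> in M. T (\<lambda>e. \<xi> e \<omega>) = 0"
    and T1: "\<forall>y\<in>scaled \<delta> branch_vectors. AE \<omega> in M. T (\<lambda>e. y e + \<xi> e \<omega>) = 1"
    unfolding admits_detection_def by blast
  interpret white: prob_space "white :: (edge \<Rightarrow> real) measure" by (rule prob_space_white)
  define A where "A = {z. T z = 1}"
  have "T -` {1} \<inter> space borel \<in> sets borel" using T by (rule measurable_sets) simp
  then have A [measurable]: "A \<in> sets borel" by (simp add: A_def vimage_def)
  have law: "(AE \<omega> in M. P (\<lambda>e. \<xi> e \<omega>)) \<longleftrightarrow> (AE z in white. P z)" if "{z. P z} \<in> sets borel" for P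
  proof -
    have "{z \<in> space borel. P z} \<in> sets borel" using that by simp
    from AE_distr_iff[OF standard_gaussian_family_measurable[OF \<xi>] this] show ?thesis
      unfolding standard_gaussian_family_law[OF \<xi>] ..
  qed
  have "AE \<omega> in M. (\<lambda>e. \<xi> e \<omega>) \<notin> A" using T0 by eventually_elim (simp add: A_def)
  then have "AE z in white. z \<notin> A"
    using law[of "\<lambda>z. z \<notin> A"] sets.compl_sets[OF A] by (simp add: Compl_eq_Diff_UNIV[symmetric] Compl_eq)
  then have A0: "measure white A = 0"
    using A by (subst (asm) AE_iff_measurable[where N = A]) (auto simp: measure_def)
  \<comment> \<open>Places \<open>\<delta>^2 / 2 + \<delta> * c\<close> midway between
    \<open>\<delta>^2 / 2\<close> and \<open>ln 2\<close>.\<close>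
  define c where "c = (ln 2 - \<delta>\<^sup>2 / 2) / (2 * \<delta>)"
  have "\<delta>\<^sup>2 < (sqrt (2 * ln 2))\<^sup>2" using d by (intro power_strict_mono) auto
  then have d2: "\<delta>\<^sup>2 < 2 * ln 2" by simp
  have c: "c > 0" using d(1) d2 by (simp add: c_def)
  have "\<delta> * c = (ln 2 - \<delta>\<^sup>2 / 2) / 2" using d(1) by (simp add: c_def)
  then have r: "\<delta>\<^sup>2 / 2 + \<delta> * c < ln 2" using d2 by simp
  obtain C where pos: "emeasure white {z :: nat \<Rightarrow> real. \<forall>k. (\<Sum>i<k. z i) \<le> c * k + C} > 0"
    using white_walk_below_line[OF c] .
  have "exp (\<delta>\<^sup>2 / 2 + \<delta> * c) < 2" using r by (metis exp_less_cancel_iff exp_ln zero_less_numeral)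
  then have K: "exp (\<delta> * C) / (1 - exp (\<delta>\<^sup>2 / 2 + \<delta> * c) / 2) \<ge> 0" by simp
  have "measure (planted \<delta> c C) A = 0"
    by (rule null_if_null_on_cylinders[OF _ finite_measure_planted _ _ K planted_cylinder[OF d(1) r] A A0])
       (auto intro: white.finite_measure_axioms)
  then have "emeasure (planted \<delta> c C) A = 0"
    using finite_measure.emeasure_eq_measure[OF finite_measure_planted] by simp
  moreover have "emeasure (planted \<delta> c C) A = emeasure white {z :: nat \<Rightarrow> real. \<forall>k. (\<Sum>i<k. z i) \<le> c * k + C}"
    (is "_ = emeasure white ?G")
  proof -
    have G [measurable]: "?G \<in> sets borel" by measurable
    \<comment> \<open>For each fixed branch the test succeeds almost surely, so only the barrier
      indicator is left. By reindexing, its integral is the same for all branches.\<close>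
    have "(\<integral>\<^sup>+z. (if \<forall>k. branch_sum b k z \<le> c * k + C then 1 else 0) *
      indicator A (\<lambda>e. \<delta> * indicator (range (edge_at [] b)) e + z e) \<partial>white) = emeasure white ?G" for b
    proof -
      let ?y = "\<lambda>e. \<delta> * indicator (range (edge_at [] b)) e"
      have "?y \<in> scaled \<delta> branch_vectors" unfolding scaled_branch_vectors by blast
      then have "AE \<omega> in M. (\<lambda>e. ?y e + \<xi> e \<omega>) \<in> A" using T1 by (simp add: A_def)
      moreover have sh: "(\<lambda>z e. ?y e + z e) \<in> borel_measurable borel"
        by (rule measurable_coordinatewise_then_product) simp
      have "{z. (\<lambda>e. ?y e + z e) \<in> A} \<in> sets borel"
        using measurable_sets[OF sh A] by (simp only: vimage_def space_borel Int_UNIV_right)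
      ultimately have "AE z in white. (\<lambda>e. ?y e + z e) \<in> A"
        using law[of "\<lambda>z. (\<lambda>e. ?y e + z e) \<in> A"] by blast
      then have "(\<integral>\<^sup>+z. (if \<forall>k. branch_sum b k z \<le> c * k + C then 1 else 0) *
          indicator A (\<lambda>e. ?y e + z e) \<partial>white) = (\<integral>\<^sup>+z. indicator ?G (\<lambda>i. z (edge_at [] b i)) \<partial>white)"
        by (intro nn_integral_cong_AE) (auto simp: branch_sum_def indicator_def)
      also have "\<dots> = (\<integral>\<^sup>+z. indicator ?G z \<partial>distr white borel (\<lambda>z i. z (edge_at [] b i)))"
      proof (rule nn_integral_distr[symmetric])
        show "(\<lambda>z i. z (edge_at [] b i)) \<in> borel_measurable white"
          by (rule measurable_coordinatewise_then_product) simp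
      qed simp
      also have "\<dots> = emeasure white ?G"
        by (simp add: distr_white_reindex[OF inj_edge_at])
      finally show ?thesis .
    qed
    then show ?thesis
      using prob_space.emeasure_space_1[OF prob_space_coins] by (simp add: emeasure_planted)
  qed
  ultimately show False using pos by simp
qed

theorem theorem7p1:
  fixes M :: "'a measure" and \<xi> :: "edge \<Rightarrow> 'a \<Rightarrow> real" and \<delta> :: real
  assumes "standard_gaussian_family M \<xi>"
    and "\<delta> > 0"
  shows "(\<delta> \<ge> sqrt (2 * ln 2) \<longrightarrow> admits_recovery M \<xi> (scaled \<delta> branch_vectors)) \<and>
         (\<delta> < sqrt (2 * ln 2) \<longrightarrow> \<not> admits_detection M \<xi> (scaled \<delta> branch_vectors))"
  using recovery_supercritical[OF assms(1)] no_detection_subcritical[OF assms] by blast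

end
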